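(* Let $c=\frac{\pi}{\sqrt{6}}$. For every real $u$, $$\lim_{n\to\infty}\mathbb{P}\left(\frac{L_n M_n}{\sqrt{n}}-\frac{1}{2c}\log n\le u\right)=H(u),\qquad\text{where } H(u)=\exp\left(-\frac{1}{c}e^{-cu}\right).$$
   Context: For an integer $n\ge 1$, a partition $\lambda$ of $n$ is a representation $n=\lambda_1+\lambda_2+\dots+\lambda_k$ with $k\ge 1$ and positive integers $\lambda_1\ge\lambda_2\ge\dots\ge\lambda_k$. Let $\Lambda(n)$ be the set of all partitions of $n$ and $p(n)=|\Lambda(n)|$. $\mathbb{P}$ denotes the uniform probability measure on $\Lambda(n)$, i.e. each $\lambda\in\Lambda(n)$ has probability $1/p(n)$. For $\lambda\in\Lambda(n)$, $L_n=L_n(\lambda)=\lambda_1$ is the largest part size, and $M_n=M_n(\lambda)$ is the multiplicity of the largest part, i.e. the number of indices $j\in\{1,\dots,k\}$ with $\lambda_j=\lambda_1$. $\log$ is the natural logarithm. *)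

theory Defs
  imports "HOL-Probability.Probability"
begin

definition int_partitions :: "nat \<Rightarrow> nat list set" where
  "int_partitions n =
     {ps. ps \<noteq> [] \<and> sorted_wrt (\<ge>) ps \<and> (\<forall>p\<in>set ps. p > 0) \<and> sum_list ps = n}"

definition largest_part :: "nat list \<Rightarrow> nat" where
  "largest_part ps = hd ps"

definition largest_part_mult :: "nat list \<Rightarrow> nat" where
  "largest_part_mult ps = count_list ps (hd ps)"

(* pmf_of_set is the uniform distribution only on finite nonempty sets; the next two lemmas
   show that this is the case here for every n > 0. *)

lemma finite_int_partitions: "finite (int_partitions n)"
proof (rule finite_subset)
  have "length ps \<le> sum_list ps" if "\<forall>p\<in>set ps. p > 0" for ps :: "nat list"
    using that by (induction ps) auto
  then show "int_partitions n \<subseteq> {ps. set ps \<subseteq> {..n} \<and> length ps \<le> n}"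
    by (auto simp: int_partitions_def dest: member_le_sum_list)
  show "finite {ps. set ps \<subseteq> {..n} \<and> length ps \<le> n}"
    by (rule finite_lists_length_le) simp
qed

lemma int_partitions_nonempty: "n > 0 \<Longrightarrow> int_partitions n \<noteq> {}"
proof -
  assume "n > 0"
  then have "[n] \<in> int_partitions n"
    by (simp add: int_partitions_def)
  then show ?thesis by blast
qed

definition partition_prob :: "nat \<Rightarrow> (nat list \<Rightarrow> bool) \<Rightarrow> real" where
  "partition_prob n A = measure_pmf.prob (pmf_of_set (int_partitions n)) {ps. A ps}"

end

theory Submission
  imports Defs "HOL-Real_Asymp.Real_Asymp"
begin

text \<open>
  Let \<open>p n\<close> be the number of partitions of \<open>n\<close> and \<open>p k n\<close> the number of those with all parts at
  most \<open>k\<close>. Two facts give the limit law.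

  The first is that the largest part alone has the Gumbel limit: if
  \<open>k = \<lfloor>sqrt n * (ln n / (2 * c) + u)\<rfloor>\<close>, then \<open>p k n / p n\<close> tends to \<open>exp (- exp (- c * u) / c)\<close>.
  The second is that the largest part is simple with probability tending to one: increasing the
  largest part of a partition of \<open>n - 1\<close> by one gives a partition of \<open>n\<close> whose largest part is
  simple, this map is injective, and \<open>p (n - 1) / p n\<close> tends to 1. On the event that the largest
  part is simple, the product of the largest part and its multiplicity is the largest part, so the
  two facts together prove the theorem by a sandwich argument.

  Both facts are statements about ratios of coefficients, and both follow from one application of
  the saddle point method. Write \<open>z = exp (- w)\<close> with \<open>Re w > 0\<close>, and let \<open>L k w\<close> be the logarithm
  of the product of \<open>1 / (1 - z ^ i)\<close> over all \<open>i > k\<close>, that is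
  \<open>L k w = (\<Sum>m\<ge>1. exp (- m * k * w) / (m * (exp (m * w) - 1)))\<close> (\<open>log_gf\<close> below). The generating
  function of \<open>p k\<close> is \<open>exp (L 0 w - L k w)\<close>, and hence \<open>2 * pi * p k n\<close> is the integral of
  \<open>exp (L 0 w - L k w + n * w)\<close> over the vertical segment \<open>w = x - \<i> * t\<close>, \<open>\<bar>t\<bar> \<le> pi\<close>. Take
  \<open>x = c / sqrt n\<close>, so that \<open>n = pi\<^sup>2 / (6 * x\<^sup>2)\<close>, and substitute \<open>t = s * x powr (3/2)\<close>.
  \<^item> Near the real axis, \<open>L 0 w - L 0 x\<close> is \<open>pi\<^sup>2 / 6 * (1 / w - 1 / x)\<close> up to a vanishing error
    (\<open>log_gf_expansion\<close>), since \<open>1 / (exp w - 1) - 1 / w\<close> has a derivative that is bounded near 0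
    and decays quadratically. The choice of \<open>x\<close> cancels the linear term, and the normalised integrand
    \<open>exp (L 0 w - L 0 x + n * (w - x))\<close> tends to \<open>exp (- pi\<^sup>2 / 6 * s\<^sup>2)\<close> (\<open>saddle_tendsto\<close>).
  \<^item> On the whole segment the normalised integrand is at most a constant times \<open>1 / (1 + s\<^sup>2)\<close>
    (\<open>norm_exp_log_gf_le\<close>). For a given \<open>Re w\<close>, every term of the series for \<open>L 0\<close> has its
    largest real part on the real axis, so the term \<open>m = 1\<close> alone gives a bound.
  \<^item> The remaining factor \<open>exp (- L k w)\<close> is bounded and has a limit \<open>exp (- l)\<close>, with
    \<open>l = exp (- c * u) / c\<close> for the \<open>k\<close> above (\<open>log_gf_tendsto\<close>) and \<open>l = 0\<close> for \<open>k = n\<close>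
    (\<open>log_gf_self_tendsto\<close>), where \<open>p k n = p n\<close>.

  By dominated convergence all the coefficients in question, multiplied by a factor that depends on
  \<open>n\<close> only, tend to \<open>exp (- l)\<close> times the same Gaussian integral
  (\<open>scaled_card_bounded_partitions_tendsto\<close>). Replacing \<open>n\<close> by \<open>n - 1\<close> changes the integrand by
  a factor \<open>exp (- w)\<close>, which tends to 1. Dividing two such limits gives the required ratios; the
  asymptotics of \<open>p n\<close> itself is not needed.
\<close>

section \<open>Partitions with bounded parts and their generating function\<close>

text \<open>Partitions of \<open>n\<close> into parts of size at most \<open>k\<close>, as weakly decreasing lists. Unlike
  \<open>int_partitions\<close>, this admits the empty partition of 0, as the generating function requires.\<close>

definition bounded_partitions :: "nat \<Rightarrow> nat \<Rightarrow> nat list set" where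
  "bounded_partitions k n =
     {ps. sorted_wrt (\<ge>) ps \<and> (\<forall>p\<in>set ps. 0 < p \<and> p \<le> k) \<and> sum_list ps = n}"

lemma bounded_partitions_0: "bounded_partitions 0 n = (if n = 0 then {[]} else {})"
proof -
  have "ps \<in> bounded_partitions 0 n \<longleftrightarrow> ps = [] \<and> n = 0" for ps
    by (cases ps) (auto simp: bounded_partitions_def)
  then show ?thesis by (simp add: set_eq_iff)
qed

lemma finite_bounded_partitions: "finite (bounded_partitions k n)"
proof (rule finite_subset)
  show "bounded_partitions k n \<subseteq> insert [] (int_partitions n)"
    by (auto simp: bounded_partitions_def int_partitions_def)
qed (simp add: finite_int_partitions)

lemma bounded_partitions_Suc:
  "bounded_partitions (Suc k) n = bounded_partitions k n \<union>
     (if Suc k \<le> n then Cons (Suc k) ` bounded_partitions (Suc k) (n - Suc k) else {})"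
  (is "?L = ?R")
proof
  show "?L \<subseteq> ?R"
  proof
    fix ps assume ps: "ps \<in> ?L"
    show "ps \<in> ?R"
    proof (cases "Suc k \<in> set ps")
      case True
      then obtain a r where ar: "ps = a # r" by (cases ps) auto
      with ps True have "a = Suc k"
        by (auto simp: bounded_partitions_def intro: le_antisym)
      with ps ar have "r \<in> bounded_partitions (Suc k) (n - Suc k)" "Suc k \<le> n"
        by (auto simp: bounded_partitions_def)
      with ar \<open>a = Suc k\<close> show ?thesis by auto
    next
      case False
      then have "p \<noteq> Suc k" if "p \<in> set ps" for p
        using that by auto
      with ps have "ps \<in> bounded_partitions k n"
        by (force simp: bounded_partitions_def le_Suc_eq)
      then show ?thesis by simp
    qed
  qed
  show "?R \<subseteq> ?L"
    by (auto simp: bounded_partitions_def split: if_splits)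
qed

lemma card_bounded_partitions_Suc:
  "card (bounded_partitions (Suc k) n) = card (bounded_partitions k n) +
     (if Suc k \<le> n then card (bounded_partitions (Suc k) (n - Suc k)) else 0)"
proof -
  have "bounded_partitions k n \<inter> Cons (Suc k) ` A = {}" for A
    by (auto simp: bounded_partitions_def)
  then show ?thesis
    unfolding bounded_partitions_Suc[of k n]
    by (auto simp: card_Un_disjoint finite_bounded_partitions card_image)
qed

lemma summable_bounded_partitions:
  fixes x :: real
  assumes "0 \<le> x" "x < 1"
  shows "summable (\<lambda>n. card (bounded_partitions k n) * x ^ n)"
proof (induction k)
  case 0
  show ?case
    by (rule summable_finite[of "{0}"]) (auto simp: bounded_partitions_0)
next
  case (Suc k)
  let ?a = "\<lambda>n. card (bounded_partitions k n) * x ^ n"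
  let ?b = "\<lambda>n. card (bounded_partitions (Suc k) n) * x ^ n"
  have xk: "x ^ Suc k < 1"
    using assms power_Suc_less_one[of x k] by (cases "x = 0") auto
  have bnd: "(\<Sum>n<N. ?b n) \<le> suminf ?a / (1 - x ^ Suc k)" for N
  proof -
    have "(\<Sum>n<N. ?b n) = (\<Sum>n<N. ?a n) +
       (\<Sum>n<N. if Suc k \<le> n then card (bounded_partitions (Suc k) (n - Suc k)) * x ^ n else 0)"
      unfolding sum.distrib[symmetric]
      by (intro sum.cong) (auto simp: card_bounded_partitions_Suc[of k] algebra_simps)
    also have "(\<Sum>n<N. if Suc k \<le> n then card (bounded_partitions (Suc k) (n - Suc k)) * x ^ n else 0)
       = (\<Sum>n\<in>{Suc k..<N}. card (bounded_partitions (Suc k) (n - Suc k)) * x ^ n)"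
      by (rule sum.mono_neutral_cong_right) auto
    also have "\<dots> = (\<Sum>n\<in>{..<N - Suc k}. ?b n * x ^ Suc k)"
      by (rule sum.reindex_bij_witness[of _ "\<lambda>n. n + Suc k" "\<lambda>n. n - Suc k"])
         (auto simp: power_add[symmetric] simp del: power_Suc)
    also have "\<dots> \<le> (\<Sum>n<N. ?b n * x ^ Suc k)"
      using assms by (intro sum_mono2) auto
    also have "\<dots> = x ^ Suc k * (\<Sum>n<N. ?b n)"
      by (simp add: sum_distrib_left mult_ac)
    also have "(\<Sum>n<N. ?a n) \<le> suminf ?a"
      using assms by (intro sum_le_suminf Suc) auto
    finally have "(1 - x ^ Suc k) * (\<Sum>n<N. ?b n) \<le> suminf ?a"
      by (simp add: algebra_simps)
    with xk show ?thesis
      by (simp add: pos_le_divide_eq mult.commute)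
  qed
  show ?case
    using assms by (intro bounded_imp_summable[OF _ bnd[of "Suc _", unfolded lessThan_Suc_atMost]]) auto
qed

text \<open>The generating function of partitions with bounded parts is the finite Euler product. Splitting
  off a largest part \<open>k + 1\<close> gives the recurrence that corresponds to the factor
  \<open>1 / (1 - z ^ (k + 1))\<close>.\<close>

lemma sums_bounded_partitions:
  fixes z :: complex
  assumes "norm z < 1"
  shows "(\<lambda>n. card (bounded_partitions k n) * z ^ n) sums (\<Prod>i=1..k. 1 / (1 - z ^ i))"
proof (induction k)
  case 0
  have "(\<lambda>n. card (bounded_partitions 0 n) * z ^ n) sums (\<Sum>n\<in>{0}. card (bounded_partitions 0 n) * z ^ n)"
    by (rule sums_finite) (auto simp: bounded_partitions_0)
  then show ?case by (simp add: bounded_partitions_0)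
next
  case (Suc k)
  let ?b = "\<lambda>n. of_nat (card (bounded_partitions (Suc k) n)) * z ^ n"
  have "summable ?b"
    by (rule summable_norm_cancel)
       (use summable_bounded_partitions[of "norm z" "Suc k"] assms in \<open>simp add: norm_mult norm_power\<close>)
  then have b: "?b sums suminf ?b" by (rule summable_sums)
  have "(\<lambda>n. (if Suc k \<le> n then of_nat (card (bounded_partitions (Suc k) (n - Suc k))) * z ^ n else 0))
     sums (z ^ Suc k * suminf ?b)"
  proof (rule sums_iff_shift'[THEN iffD1, of _ "Suc k"], goal_cases)
    case 1
    have "(\<lambda>n. z ^ Suc k * ?b n) sums (z ^ Suc k * suminf ?b)"
      by (intro sums_mult b)
    also have "(\<lambda>n. z ^ Suc k * ?b n) = (\<lambda>n. if Suc k \<le> n + Suc k then of_nat (card (bounded_partitions (Suc k) (n + Suc k - Suc k))) * z ^ (n + Suc k) else 0)"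
      by (simp add: power_add mult_ac)
    finally show ?case by simp
  qed
  from sums_add[OF Suc this]
  have "?b sums ((\<Prod>i=1..k. 1 / (1 - z ^ i)) + z ^ Suc k * suminf ?b)"
    by (rule sums_cong[THEN iffD1, rotated])
       (auto simp: card_bounded_partitions_Suc[of k] algebra_simps)
  with b have eq: "suminf ?b = (\<Prod>i=1..k. 1 / (1 - z ^ i)) + z ^ Suc k * suminf ?b"
    by (rule sums_unique2)
  have "norm (z ^ Suc k) < 1"
    using assms power_Suc_less_one[of "norm z" k] by (cases "z = 0") (auto simp: norm_power simp del: power_Suc)
  then have "1 - z ^ Suc k \<noteq> 0" by auto
  with eq have "suminf ?b = (\<Prod>i=1..Suc k. 1 / (1 - z ^ i))"
    by (simp add: field_simps)
  with b show ?case by simp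
qed

lemma int_partitions_le_eq_bounded_partitions:
  assumes "n > 0"
  shows "{ps \<in> int_partitions n. largest_part ps \<le> k} = bounded_partitions k n"
proof -
  have "(ps \<noteq> [] \<and> sorted_wrt (\<ge>) ps \<and> (\<forall>p\<in>set ps. p > 0) \<and> sum_list ps = n \<and> hd ps \<le> k)
     \<longleftrightarrow> (sorted_wrt (\<ge>) ps \<and> (\<forall>p\<in>set ps. 0 < p \<and> p \<le> k) \<and> sum_list ps = n)" for ps
    using assms by (cases ps) auto
  then show ?thesis
    by (simp add: int_partitions_def bounded_partitions_def largest_part_def conj_assoc)
qed

lemma int_partitions_eq_bounded_partitions:
  assumes "n > 0" "n \<le> k"
  shows "int_partitions n = bounded_partitions k n"
proof -
  have "largest_part ps \<le> k" if "ps \<in> int_partitions n" for ps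
    using that assms by (cases ps) (auto simp: int_partitions_def largest_part_def)
  then show ?thesis
    using int_partitions_le_eq_bounded_partitions[OF assms(1), of k] by auto
qed

text \<open>Increasing the largest part by one maps the partitions of \<open>n\<close> injectively to partitions of
  \<open>n + 1\<close> with a simple largest part.\<close>

lemma card_int_partitions_le_unique_largest:
  "card (int_partitions n) \<le> card {ps \<in> int_partitions (Suc n). largest_part_mult ps = 1}"
proof (rule card_inj_on_le)
  let ?f = "\<lambda>ps::nat list. Suc (hd ps) # tl ps"
  show "inj_on ?f (int_partitions n)"
    by (rule inj_onI) (auto simp: int_partitions_def neq_Nil_conv)
  show "?f ` int_partitions n \<subseteq> {ps \<in> int_partitions (Suc n). largest_part_mult ps = 1}"
  proof
    fix qs assume "qs \<in> ?f ` int_partitions n"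
    then obtain ps where ps: "ps \<in> int_partitions n" "qs = ?f ps" by auto
    then obtain a r where ar: "ps = a # r" by (cases ps) (auto simp: int_partitions_def)
    have *: "\<forall>x\<in>set r. x \<le> a"
      using ps ar by (auto simp: int_partitions_def)
    then have "Suc a \<notin> set r" by auto
    then have "count_list r (Suc a) = 0"
      by (simp add: count_list_0_iff)
    with ps ar * show "qs \<in> {ps \<in> int_partitions (Suc n). largest_part_mult ps = 1}"
      by (auto simp: int_partitions_def largest_part_mult_def)
  qed
  show "finite {ps \<in> int_partitions (Suc n). largest_part_mult ps = 1}"
    by (simp add: finite_int_partitions)
qed

section \<open>The logarithm of the generating function\<close>

text \<open>The logarithm of \<open>\<Prod>i>k. 1 / (1 - exp (- w) ^ i)\<close> for \<open>Re w > 0\<close>. It is given by the series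
  that results from expanding the logarithm of each factor and summing the geometric series over
  \<open>i\<close>; the index \<open>m\<close> starts at 0, so that \<open>Suc m\<close> is the exponent in the expansion of the logarithm.
  This form avoids infinite products and the choice of a branch of the logarithm.\<close>

definition log_gf :: "nat \<Rightarrow> complex \<Rightarrow> complex" where
  "log_gf k w = (\<Sum>m. exp (- (of_nat (Suc m) * of_nat k * w)) /
     (of_nat (Suc m) * (exp (of_nat (Suc m) * w) - 1)))"

lemma norm_exp_minus_one_ge: "exp (Re w) - 1 \<le> norm (exp w - 1)"
  using norm_triangle_ineq2[of "exp w" 1] by simp

lemma norm_exp_minus_one_ge_Re: "Re w \<le> norm (exp w - 1)"
  using norm_exp_minus_one_ge[of w] exp_ge_add_one_self[of "Re w"] by linarith

lemma norm_log_gf_term_le: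
  assumes "Re w > 0"
  shows "norm (exp (- (of_nat (Suc m) * of_nat k * w)) / (of_nat (Suc m) * (exp (of_nat (Suc m) * w) - 1)))
     \<le> exp (- (real k * Re w)) ^ Suc m / Re w * (1 / (real m + 1)\<^sup>2)"
proof -
  have "norm (exp (- (of_nat (Suc m) * of_nat k * w))) = exp (- (real k * Re w)) ^ Suc m"
    unfolding exp_of_nat_mult[symmetric] by (simp add: mult_ac)
  moreover have "Suc m * Re w \<le> norm (exp (of_nat (Suc m) * w) - 1)"
    using norm_exp_minus_one_ge_Re[of "of_nat (Suc m) * w"] by simp
  then have "(real m + 1)\<^sup>2 * Re w \<le> norm (of_nat (Suc m) * (exp (of_nat (Suc m) * w) - 1))"
    unfolding norm_mult norm_of_nat
    using mult_left_mono[of "Suc m * Re w" "norm (exp (of_nat (Suc m) * w) - 1)" "real (Suc m)"]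
    by (simp add: power2_eq_square algebra_simps)
  ultimately show ?thesis
    using assms unfolding norm_divide
    by (auto intro!: divide_left_mono mult_pos_pos simp: mult.commute intro: order.strict_trans2[rotated])
qed

lemma summable_log_gf:
  assumes "Re w > 0"
  shows "summable (\<lambda>m. exp (- (of_nat (Suc m) * of_nat k * w)) /
     (of_nat (Suc m) * (exp (of_nat (Suc m) * w) - 1)))" (is "summable ?T")
proof (rule summable_comparison_test')
  show "summable (\<lambda>m. 1 / Re w * (1 / (real m + 1)\<^sup>2))"
    using inverse_squares_sums by (intro summable_mult) (auto simp: sums_iff add_ac)
  fix m :: nat assume "m \<ge> 0"
  have "exp (- (real k * Re w)) ^ Suc m \<le> 1"
    using assms by (intro power_le_one) auto
  then have "exp (- (real k * Re w)) ^ Suc m / Re w * (1 / (real m + 1)\<^sup>2) \<le> 1 / Re w * (1 / (real m + 1)\<^sup>2)"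
    using assms by (intro mult_right_mono divide_right_mono) auto
  with norm_log_gf_term_le[OF assms, of m k]
  show "norm (?T m) \<le> 1 / Re w * (1 / (real m + 1)\<^sup>2)"
    by linarith
qed

lemma norm_log_gf_le:
  assumes "Re w > 0"
  shows "norm (log_gf k w) \<le> exp (- (real k * Re w)) / Re w * (pi\<^sup>2 / 6)"
proof (rule norm_sums_le)
  let ?T = "\<lambda>m. exp (- (of_nat (Suc m) * of_nat k * w)) / (of_nat (Suc m) * (exp (of_nat (Suc m) * w) - 1))"
  show "?T sums log_gf k w"
    unfolding log_gf_def using assms by (intro summable_sums summable_log_gf)
  show "(\<lambda>m. exp (- (real k * Re w)) / Re w * (1 / (real m + 1)\<^sup>2)) sums (exp (- (real k * Re w)) / Re w * (pi\<^sup>2 / 6))"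
    using inverse_squares_sums by (intro sums_mult) (simp add: add_ac)
  fix m
  have "exp (- (real k * Re w)) ^ Suc m \<le> exp (- (real k * Re w)) ^ 1"
    using assms by (intro power_decreasing) auto
  then have "exp (- (real k * Re w)) ^ Suc m / Re w * (1 / (real m + 1)\<^sup>2)
      \<le> exp (- (real k * Re w)) / Re w * (1 / (real m + 1)\<^sup>2)"
    using assms by (intro mult_right_mono divide_right_mono) auto
  with norm_log_gf_term_le[OF assms, of m k]
  show "norm (?T m) \<le> exp (- (real k * Re w)) / Re w * (1 / (real m + 1)\<^sup>2)"
    by linarith
qed

lemma exp_log_gf_diff:
  assumes "Re w > 0"
  shows "exp (log_gf k w - log_gf (Suc k) w) = 1 / (1 - exp (- w) ^ Suc k)"
proof -
  let ?T = "\<lambda>k m. exp (- (of_nat (Suc m) * of_nat k * w)) /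
     (of_nat (Suc m) * (exp (of_nat (Suc m) * w) - 1))"
  let ?z = "exp (- w) ^ Suc k"
  have z: "norm ?z < 1"
    using assms power_Suc_less_one[of "exp (- Re w)" k] by (simp add: norm_power norm_mult del: power_Suc)
  have "(\<lambda>m. ?T k m - ?T (Suc k) m) sums (log_gf k w - log_gf (Suc k) w)"
    unfolding log_gf_def using assms by (intro sums_diff summable_sums summable_log_gf)
  also have "(\<lambda>m. ?T k m - ?T (Suc k) m) = (\<lambda>m. ?z ^ Suc m / of_nat (Suc m))"
  proof
    fix m
    let ?e = "exp (of_nat (Suc m) * w)"
    have "0 < real (Suc m) * Re w" using assms by (intro mult_pos_pos) auto
    moreover have "real (Suc m) * Re w \<le> norm (?e - 1)"
      using norm_exp_minus_one_ge_Re[of "of_nat (Suc m) * w"] by simp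
    ultimately have "0 < norm (?e - 1)" by (rule order.strict_trans2)
    then have "?e - 1 \<noteq> 0" unfolding zero_less_norm_iff .
    have "exp (- (of_nat (Suc m) * of_nat (Suc k) * w)) = exp (- (of_nat (Suc m) * of_nat k * w)) * exp (- (of_nat (Suc m) * w))"
      unfolding exp_add[symmetric] by (simp add: algebra_simps)
    also have "exp (- (of_nat (Suc m) * w)) = 1 / ?e"
      by (simp only: exp_minus inverse_eq_divide)
    finally have 1: "exp (- (of_nat (Suc m) * of_nat k * w)) = exp (- (of_nat (Suc m) * of_nat (Suc k) * w)) * ?e"
      by simp
    have 2: "?T k m - ?T (Suc k) m = exp (- (of_nat (Suc m) * of_nat (Suc k) * w)) / of_nat (Suc m)"
      unfolding 1 using \<open>?e - 1 \<noteq> 0\<close> by (simp add: divide_simps del: of_nat_Suc) (simp add: algebra_simps)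
    have 3: "exp (- (of_nat (Suc m) * of_nat (Suc k) * w)) = ?z ^ Suc m"
      unfolding power_mult[symmetric] exp_of_nat_mult[symmetric] by (simp add: algebra_simps)
    show "?T k m - ?T (Suc k) m = ?z ^ Suc m / of_nat (Suc m)"
      unfolding 2 unfolding 3 ..
  qed
  finally have 1: "(\<lambda>m. ?z ^ Suc m / of_nat (Suc m)) sums (log_gf k w - log_gf (Suc k) w)" .
  have "(\<lambda>m. - (?z ^ m) / of_nat m) sums ln (1 - ?z)"
    using Ln_series'[of "- ?z"] z by (simp del: power_Suc)
  then have "(\<lambda>m. - (?z ^ Suc m) / of_nat (Suc m)) sums ln (1 - ?z)"
    using sums_Suc_iff[of "\<lambda>m. - (?z ^ m) / of_nat m"] by (simp del: power_Suc of_nat_Suc)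
  from sums_minus[OF this] 1 have "log_gf k w - log_gf (Suc k) w = - ln (1 - ?z)"
    by (intro sums_unique2) (auto simp del: power_Suc of_nat_Suc)
  moreover have "1 - ?z \<noteq> 0" using z by auto
  ultimately show ?thesis
    by (simp add: exp_minus inverse_eq_divide del: power_Suc)
qed

lemma prod_eq_exp_log_gf:
  assumes "Re w > 0"
  shows "(\<Prod>i=1..k. 1 / (1 - exp (- w) ^ i)) = exp (log_gf 0 w - log_gf k w)"
proof (induction k)
  case (Suc k)
  have "exp (log_gf 0 w - log_gf (Suc k) w) = exp (log_gf 0 w - log_gf k w) * exp (log_gf k w - log_gf (Suc k) w)"
    unfolding exp_add[symmetric] by simp
  with Suc show ?case unfolding exp_log_gf_diff[OF assms] by simp
qed simp

lemma borel_measurable_log_gf [measurable]: "log_gf k \<in> borel_measurable borel"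
  unfolding log_gf_def by measurable

lemma third_le_sin:
  fixes h :: real
  assumes "0 \<le> h" "h \<le> pi / 2"
  shows "h / 3 \<le> sin h"
proof -
  have "h \<le> 2" using assms pi_less_4 by simp
  then have "h ^ 3 \<le> 4 * h"
    using assms power_mono[of h 2 2] mult_right_mono[of "h\<^sup>2" 4 h] by (simp add: power2_eq_square power3_eq_cube)
  moreover have "\<bar>sin h - h\<bar> \<le> h ^ 3 / 6"
    using Maclaurin_sin_bound[of h 3] assms
    by (simp add: numeral_3_eq_3 sin_coeff_def fact_numeral divide_simps)
  ultimately show ?thesis by linarith
qed

text \<open>Since \<open>Re (1 / (exp v - 1)) \<le> norm (1 / (exp v - 1)) \<le> 1 / (exp (Re v) - 1)\<close> for
  \<open>Re v > 0\<close>, no term of the series for \<open>log_gf 0\<close> contributes positively to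
  the left-hand side, and all terms but the first may be dropped.\<close>

lemma Re_log_gf_diff_le:
  assumes "x > 0"
  shows "Re (log_gf 0 (Complex x t)) - Re (log_gf 0 (of_real x))
    \<le> Re (1 / (exp (Complex x t) - 1)) - 1 / (exp x - 1)"
proof -
  let ?T = "\<lambda>w m. 1 / (of_nat (Suc m) * (exp (of_nat (Suc m) * w) - 1) :: complex)"
  let ?w = "Complex x t"
  let ?f = "\<lambda>m. Re (?T ?w m - ?T (of_real x) m)"
  have "(\<lambda>m. ?T w m) sums log_gf 0 w" if "Re w > 0" for w
    using summable_sums[OF summable_log_gf[OF that, of 0]] by (simp add: log_gf_def del: of_nat_Suc)
  from sums_diff[OF this[of ?w] this[of "of_real x"]] assms
  have f: "?f sums (Re (log_gf 0 ?w) - Re (log_gf 0 (of_real x)))"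
    unfolding minus_complex.sel(1)[symmetric] by (intro sums_Re) simp
  have Tx: "?T (of_real x) m = of_real (1 / (Suc m * (exp (Suc m * x) - 1)))" for m
    by (simp add: exp_of_real[symmetric])
  have neg: "?f m \<le> 0" for m
  proof -
    have pos: "0 < Suc m * (exp (Suc m * x) - 1)"
      using assms by (intro mult_pos_pos) auto
    have norm_ge: "norm (of_nat (Suc m) * (exp (of_nat (Suc m) * ?w) - 1)) \<ge> Suc m * (exp (Suc m * x) - 1)"
      unfolding norm_mult norm_of_nat
      using norm_exp_minus_one_ge[of "of_nat (Suc m) * ?w"] by (intro mult_left_mono) auto
    have "norm (?T ?w m) \<le> 1 / (Suc m * (exp (Suc m * x) - 1))"
      unfolding norm_divide norm_one
      by (intro divide_left_mono norm_ge mult_pos_pos pos order.strict_trans2[OF pos norm_ge]) simp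
    moreover have "Re (?T ?w m) \<le> norm (?T ?w m)" by (rule complex_Re_le_cmod)
    ultimately show ?thesis unfolding minus_complex.sel(1) Tx Re_complex_of_real by linarith
  qed
  have "(\<lambda>m. g (Suc m)) sums (a - g 0)" if "g sums a" for g :: "nat \<Rightarrow> real" and a
    by (simp add: sums_Suc_iff that)
  from this[OF f] have "Re (log_gf 0 ?w) - Re (log_gf 0 (of_real x)) - ?f 0 \<le> 0"
    by (rule sums_le[OF neg _ sums_zero])
  moreover have "?f 0 = Re (1 / (exp ?w - 1)) - 1 / (exp x - 1)"
    unfolding minus_complex.sel(1) Tx Re_complex_of_real by simp
  ultimately show ?thesis by linarith
qed

lemma Re_inverse_exp_minus_one:
  assumes x: "0 < x" "x \<le> 1" and t: "\<bar>t\<bar> \<le> pi"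
  shows "Re (1 / (exp (Complex x t) - 1)) - 1 / (exp x - 1) \<le> - (t\<^sup>2 / (2 * x * (36 * x\<^sup>2 + t\<^sup>2)))"
proof (cases "t = 0")
  case True
  have "1 / (exp (complex_of_real x) - 1) = of_real (1 / (exp x - 1))"
    by (simp add: exp_of_real[symmetric])
  then show ?thesis using True by (simp only: complex_of_real_def[symmetric] Re_complex_of_real) simp
next
  case False
  \<comment> \<open>With \<open>w = Complex x t\<close>, these satisfy \<open>(norm (exp w - 1))\<^sup>2 = d\<^sup>2 + y\<close> and \<open>Re (exp w - 1) = d - y / 2\<close>.\<close>
  define d where "d = exp x - 1"
  define y where "y = 2 * exp x * (1 - cos t)"
  have "0 < d" using x by (simp add: d_def)
  moreover have "x\<^sup>2 \<le> x"
    using x mult_left_mono[of x 1 x] by (simp add: power2_eq_square)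
  then have "d \<le> 2 * x"
    using x exp_bound[of x] unfolding d_def by linarith
  ultimately have d: "0 < d" "d \<le> 2 * x" .
  have "t\<^sup>2 / 18 \<le> 1 - cos t"
  proof -
    have "(\<bar>t\<bar> / 6)\<^sup>2 \<le> (sin (\<bar>t\<bar> / 2))\<^sup>2"
      using third_le_sin[of "\<bar>t\<bar> / 2"] t by (intro power_mono) auto
    moreover have "cos t = 1 - 2 * (sin (\<bar>t\<bar> / 2))\<^sup>2"
      using cos_double_sin[of "\<bar>t\<bar> / 2"] by simp
    ultimately show ?thesis by (simp add: power_divide)
  qed
  moreover have "2 * (1 - cos t) \<le> y"
    using x unfolding y_def by (intro mult_right_mono) auto
  ultimately have y: "t\<^sup>2 / 9 \<le> y" "0 < y" using False
    by (auto intro: order.strict_trans2[of 0 "t\<^sup>2 / 9"])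
  have "Re (1 / (exp (Complex x t) - 1)) = (exp x * cos t - 1) / ((exp x * cos t - 1)\<^sup>2 + (exp x * sin t)\<^sup>2)"
    by (simp add: Re_divide Re_exp Im_exp)
  also have y2: "exp x * cos t - 1 = d - y / 2"
  proof -
    have "y / 2 = exp x * (1 - cos t)" by (simp add: y_def)
    then show ?thesis by (simp add: d_def algebra_simps)
  qed
  also have "(d - y / 2)\<^sup>2 + (exp x * sin t)\<^sup>2 = d\<^sup>2 + y"
  proof -
    have "(exp x * cos t - 1)\<^sup>2 + (exp x * sin t)\<^sup>2 = (exp x)\<^sup>2 * ((cos t)\<^sup>2 + (sin t)\<^sup>2) - 2 * exp x * cos t + 1"
      by algebra
    also have "(cos t)\<^sup>2 + (sin t)\<^sup>2 = 1" by simp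
    also have "(exp x)\<^sup>2 * 1 - 2 * exp x * cos t + 1 = d\<^sup>2 + y"
      unfolding d_def y_def by algebra
    finally show ?thesis unfolding y2 .
  qed
  finally have "Re (1 / (exp (Complex x t) - 1)) - 1 / (exp x - 1) = (d - y / 2) / (d\<^sup>2 + y) - 1 / d"
    by (simp only: d_def)
  also have "\<dots> = - (y * (1 + d / 2) / (d * (d\<^sup>2 + y)))"
  proof -
    have "d\<^sup>2 + y > 0" "d \<noteq> 0" using d y by (auto intro: add_nonneg_pos)
    then show ?thesis by (simp add: divide_simps) (simp add: power2_eq_square algebra_simps)
  qed
  also have "\<dots> \<le> - (t\<^sup>2 / (2 * x * (36 * x\<^sup>2 + t\<^sup>2)))"
  proof -
    have "t\<^sup>2 / (2 * x * (36 * x\<^sup>2 + t\<^sup>2)) \<le> t\<^sup>2 / (d * (9 * d\<^sup>2 + t\<^sup>2))"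
    proof (intro divide_left_mono)
      have "d\<^sup>2 \<le> (2 * x)\<^sup>2" using d by (intro power_mono) auto
      then have "9 * d\<^sup>2 + t\<^sup>2 \<le> 36 * x\<^sup>2 + t\<^sup>2" by (simp add: power_mult_distrib)
      with d x show "d * (9 * d\<^sup>2 + t\<^sup>2) \<le> 2 * x * (36 * x\<^sup>2 + t\<^sup>2)"
        by (intro mult_mono) auto
      show "0 < 2 * x * (36 * x\<^sup>2 + t\<^sup>2) * (d * (9 * d\<^sup>2 + t\<^sup>2))"
        using x d by (intro mult_pos_pos add_pos_nonneg) auto
    qed auto
    also have "\<dots> = (t\<^sup>2 / 9) / (d * (d\<^sup>2 + t\<^sup>2 / 9))"
      using d by (simp add: divide_simps)
    also have "\<dots> \<le> y / (d * (d\<^sup>2 + y))"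
    proof -
      have "d * (d\<^sup>2 * (t\<^sup>2 / 9)) \<le> d * (d\<^sup>2 * y)"
        using y d by (intro mult_left_mono) auto
      then have "(t\<^sup>2 / 9) * (d * (d\<^sup>2 + y)) \<le> y * (d * (d\<^sup>2 + t\<^sup>2 / 9))"
        by (simp add: algebra_simps)
      moreover have "d * (d\<^sup>2 + t\<^sup>2 / 9) > 0" "d * (d\<^sup>2 + y) > 0"
        using d y by (auto intro!: mult_pos_pos add_pos_nonneg)
      ultimately show ?thesis by (simp only: pos_divide_le_eq pos_le_divide_eq times_divide_eq_left)
    qed
    also have "\<dots> \<le> y * (1 + d / 2) / (d * (d\<^sup>2 + y))"
      using d y by (intro divide_right_mono) (auto simp: algebra_simps)
    finally show ?thesis by simp
  qed
  finally show ?thesis .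
qed

lemma exp_minus_le_inverse_cube:
  fixes X :: real
  assumes "X > 0"
  shows "exp (- X) \<le> 6 / X ^ 3"
proof -
  have "X ^ 3 / fact 3 \<le> exp X"
    using Maclaurin_exp_le[of X 4] assms
    by (auto simp: eval_nat_numeral lessThan_Suc add_nonneg_nonneg)
  then show ?thesis using assms
    by (simp add: exp_minus field_simps fact_numeral)
qed

text \<open>The bound for dominated convergence, with \<open>t = s * x powr (3/2)\<close>. It holds for all
  \<open>\<bar>t\<bar> \<le> pi\<close>, so no separate treatment of the part far from the saddle point is needed. The
  exponent \<open>X\<close> behaves like \<open>s\<^sup>2\<close> for small \<open>t\<close> but only like \<open>\<bar>s\<bar> powr (2/3)\<close> at the ends, which is
  why \<open>exp (- X)\<close> is compared with \<open>1 / X ^ 3\<close>. The value of the constant is immaterial.\<close>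

lemma norm_exp_log_gf_le:
  assumes x: "0 < x" "x \<le> 1" and t: "\<bar>t\<bar> \<le> pi" and s: "t\<^sup>2 = s\<^sup>2 * x ^ 3"
  shows "norm (exp (log_gf 0 (Complex x t) - log_gf 0 (of_real x))) \<le> 20000000 / (1 + s\<^sup>2)"
proof -
  define y where "y = s\<^sup>2 * x"
  define X where "X = s\<^sup>2 / (2 * (36 + y))"
  have y: "y \<ge> 0" using x by (simp add: y_def)
  have "2 * x * (36 * x\<^sup>2 + t\<^sup>2) = x ^ 3 * (2 * (36 + y))"
    unfolding s y_def by (simp add: power2_eq_square power3_eq_cube algebra_simps)
  then have "t\<^sup>2 / (2 * x * (36 * x\<^sup>2 + t\<^sup>2)) = X"
    using x unfolding s X_def by simp
  with Re_log_gf_diff_le[OF x(1), of t] Re_inverse_exp_minus_one[OF x t]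
  have 1: "norm (exp (log_gf 0 (Complex x t) - log_gf 0 (of_real x))) \<le> exp (- X)"
    by simp
  show ?thesis
  proof (cases "s\<^sup>2 \<le> 1")
    case True
    have "exp (- X) \<le> 1" using y by (simp add: X_def)
    also have "\<dots> \<le> 20000000 / (1 + s\<^sup>2)" using True by (simp add: divide_simps add_pos_nonneg)
    finally show ?thesis by (rule order_trans[OF 1])
  next
    case False
    then have X: "X > 0" using y unfolding X_def by (intro divide_pos_pos) auto
    have "y ^ 3 = t\<^sup>2 * (s\<^sup>2)\<^sup>2"
      unfolding s y_def by (simp add: power_mult_distrib power2_eq_square power3_eq_cube)
    also have "t\<^sup>2 \<le> 4\<^sup>2"
      using t pi_less_4 by (intro power2_le_iff_abs_le[THEN iffD2]) auto
    finally have y3: "y ^ 3 \<le> 16 * (s\<^sup>2)\<^sup>2" by (simp add: mult_right_mono)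
    \<comment> \<open>The power mean inequality \<open>(a + y) ^ 3 \<le> 4 * (a ^ 3 + y ^ 3)\<close> with \<open>a = 36\<close>.\<close>
    have "0 \<le> 3 * (36 + y) * (36 - y)\<^sup>2" using y by simp
    also have "\<dots> = 4 * (36 ^ 3 + y ^ 3) - (36 + y) ^ 3"
      by (simp add: power2_eq_square power3_eq_cube algebra_simps)
    finally have "(36 + y) ^ 3 \<le> 4 * (36 ^ 3 + y ^ 3)" by (simp only: diff_ge_0_iff_ge)
    also have "\<dots> \<le> 4 * (36 ^ 3 + 16 * (s\<^sup>2)\<^sup>2)" using y3 by (intro mult_left_mono add_left_mono) auto
    also have "\<dots> \<le> 186688 * (s\<^sup>2)\<^sup>2"
      using False power_mono[of 1 "s\<^sup>2" 2] by simp
    finally have y4: "(36 + y) ^ 3 \<le> 186688 * (s\<^sup>2)\<^sup>2" .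
    have "exp (- X) \<le> 6 / X ^ 3" by (rule exp_minus_le_inverse_cube[OF X])
    also have "X ^ 3 = (s\<^sup>2) ^ 3 / (8 * (36 + y) ^ 3)"
      unfolding X_def power_divide power_mult_distrib by simp
    also have "6 / \<dots> = 48 * (36 + y) ^ 3 / (s\<^sup>2) ^ 3" by simp
    also have "\<dots> \<le> 48 * (186688 * (s\<^sup>2)\<^sup>2) / (s\<^sup>2) ^ 3"
      using y4 by (intro divide_right_mono mult_left_mono) auto
    also have "\<dots> = 8961024 / s\<^sup>2"
      using False by (simp add: power2_eq_square power3_eq_cube)
    also have "\<dots> \<le> 20000000 / (1 + s\<^sup>2)"
      using False by (simp add: divide_simps add_pos_nonneg)
    finally show ?thesis by (rule order_trans[OF 1])
  qed
qed

section \<open>The behaviour at the saddle point\<close>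

lemma exp_2_le_9: "exp 2 \<le> (9::real)"
proof -
  have "exp 2 = (exp (1::real))\<^sup>2" using exp_of_nat_mult[of 2 "1::real"] by simp
  also have "\<dots> \<le> 3\<^sup>2" using exp_le by (intro power_mono) auto
  finally show ?thesis by simp
qed

text \<open>The function \<open>1 / w\<^sup>2 - exp w / (exp w - 1)\<^sup>2\<close> is the derivative of
  \<open>1 / (exp w - 1) - 1 / w\<close>. The next three lemmas bound it in terms of \<open>Re w\<close>, for
  \<open>Re w \<le> 1\<close> only in the sector \<open>\<bar>Im w\<bar> \<le> Re w\<close>.\<close>

lemma inverse_square_minus_exp_bound_large:
  assumes w: "1 \<le> Re w"
  shows "norm (1 / w\<^sup>2 - exp w / (exp w - 1)\<^sup>2) \<le> 9 / (Re w)\<^sup>2"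
proof -
  let ?r = "Re w"
  have "norm (1 / w\<^sup>2) \<le> 1 / ?r\<^sup>2"
    unfolding norm_divide norm_power norm_one using w complex_Re_le_cmod[of w]
    by (intro divide_left_mono power_mono mult_pos_pos) auto
  moreover have "norm (exp w / (exp w - 1)\<^sup>2) \<le> 8 / ?r\<^sup>2"
  proof -
    have "2 \<le> exp ?r" using exp_ge_add_one_self[of ?r] w by linarith
    then have le: "exp ?r / 2 \<le> norm (exp w - 1)"
      using norm_exp_minus_one_ge[of w] by simp
    have "norm (exp w / (exp w - 1)\<^sup>2) = exp ?r / (norm (exp w - 1))\<^sup>2"
      by (simp add: norm_divide norm_power)
    also have "\<dots> \<le> exp ?r / (exp ?r / 2)\<^sup>2"
    proof (intro divide_left_mono power_mono mult_pos_pos zero_less_power)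
      show "0 < norm (exp w - 1)" by (rule order.strict_trans2[OF _ le]) simp
    qed (use le in auto)
    also have "\<dots> = 4 / exp ?r" by (simp add: power2_eq_square)
    also have "\<dots> \<le> 4 / (?r\<^sup>2 / 2)"
    proof (intro divide_left_mono)
      show "?r\<^sup>2 / 2 \<le> exp ?r"
        using exp_lower_Taylor_quadratic[of ?r] w by linarith
    qed (use w in auto)
    finally show ?thesis by simp
  qed
  ultimately show ?thesis
    using norm_triangle_ineq4[of "1 / w\<^sup>2" "exp w / (exp w - 1)\<^sup>2"] by (simp add: add_divide_distrib[symmetric])
qed

lemma inverse_square_minus_exp_bound_small:
  assumes w: "0 < Re w" "Re w \<le> 1" "\<bar>Im w\<bar> \<le> Re w"
  shows "norm (1 / w\<^sup>2 - exp w / (exp w - 1)\<^sup>2) \<le> 500"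
proof -
  define b where "b = norm w"
  \<comment> \<open>Taylor remainders: after putting both fractions over a common denominator, the terms of the
    numerator of order less than four cancel.\<close>
  define d1 where "d1 = exp w - (1 + w)"
  define d2 where "d2 = exp w - (1 + w + w\<^sup>2 / 2)"
  have b: "0 < b" "b \<le> 2 * Re w" "b \<le> 2"
    using w cmod_le[of w] unfolding b_def by (auto intro: order.strict_trans2[OF w(1) complex_Re_le_cmod])
  have eb: "exp b \<le> 9" using exp_2_le_9 b exp_le_cancel_iff[of b 2] by linarith
  have "norm d1 \<le> exp b * b\<^sup>2"
    using Taylor_exp_field[of w 1] by (simp add: d1_def b_def eval_nat_numeral)
  also have "\<dots> \<le> 9 * b\<^sup>2" using eb by (intro mult_right_mono) auto
  finally have d1: "norm d1 \<le> 9 * b\<^sup>2" .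
  have "norm d2 \<le> exp b * b ^ 3 / 2"
    using Taylor_exp_field[of w 2] by (simp add: d2_def b_def eval_nat_numeral)
  also have "\<dots> \<le> 9 * b ^ 3 / 2" using eb b by (intro divide_right_mono mult_right_mono) auto
  finally have d2: "norm d2 \<le> 9 * b ^ 3 / 2" .
  have ew: "exp w = 1 + w + d1" "exp w - 1 = w + w\<^sup>2 / 2 + d2"
    by (simp_all add: d1_def d2_def)
  have "(exp w - 1)\<^sup>2 - w\<^sup>2 * exp w = w ^ 4 / 4 + d2 * d2 + 2 * w * d2 + w\<^sup>2 * d2 - w\<^sup>2 * d1"
    (is "?N = ?P")
    unfolding ew(2) unfolding ew(1) by (simp add: power2_eq_square eval_nat_numeral algebra_simps)
  have "norm ?P \<le> b ^ 4 / 4 + norm d2 * norm d2 + 2 * b * norm d2 + b\<^sup>2 * norm d2 + b\<^sup>2 * norm d1"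
    unfolding b_def
    by (rule norm_triangle_le_diff order_trans[OF norm_triangle_ineq4] order_trans[OF norm_triangle_ineq] add_mono)+
       (auto simp: norm_mult norm_power norm_divide)
  also have "\<dots> \<le> b ^ 4 / 4 + (9 * b ^ 3 / 2) * (9 * b ^ 3 / 2) + 2 * b * (9 * b ^ 3 / 2) + b\<^sup>2 * (9 * b ^ 3 / 2) + b\<^sup>2 * (9 * b\<^sup>2)"
    using d1 d2 b by (intro add_mono mult_mono mult_left_mono) auto
  also have "\<dots> = b ^ 4 * (1 / 4 + 81 / 4 * b\<^sup>2 + 9 + 9 / 2 * b + 9)"
    by (simp add: power2_eq_square eval_nat_numeral algebra_simps)
  also have "\<dots> \<le> b ^ 4 * 125"
  proof (intro mult_left_mono)
    have "b\<^sup>2 \<le> 2\<^sup>2" using b by (intro power_mono) auto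
    then show "1 / 4 + 81 / 4 * b\<^sup>2 + 9 + 9 / 2 * b + 9 \<le> 125" using b by simp
  qed (use b in auto)
  finally have N: "norm ?N \<le> b ^ 4 * 125"
    using \<open>?N = ?P\<close> by simp
  have "b / 2 \<le> norm (exp w - 1)"
    using norm_exp_minus_one_ge_Re[of w] b by linarith
  then have "(b / 2)\<^sup>2 \<le> (norm (exp w - 1))\<^sup>2" using b by (intro power_mono) auto
  then have D: "b\<^sup>2 * (b / 2)\<^sup>2 \<le> norm (w\<^sup>2 * (exp w - 1)\<^sup>2)"
    unfolding norm_mult norm_power b_def by (intro mult_left_mono) auto
  have nz: "w \<noteq> 0" "exp w - 1 \<noteq> 0"
    using b norm_exp_minus_one_ge_Re[of w] w by (auto simp: b_def)
  have pos: "0 < b\<^sup>2 * (b / 2)\<^sup>2" using b by simp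
  have "1 / w\<^sup>2 - exp w / (exp w - 1)\<^sup>2 = ?N / (w\<^sup>2 * (exp w - 1)\<^sup>2)"
    using nz by (simp add: diff_frac_eq)
  then have "norm (1 / w\<^sup>2 - exp w / (exp w - 1)\<^sup>2) = norm ?N / norm (w\<^sup>2 * (exp w - 1)\<^sup>2)"
    by (simp only: norm_divide)
  also have "\<dots> \<le> b ^ 4 * 125 / (b\<^sup>2 * (b / 2)\<^sup>2)"
    by (intro frac_le N D pos) auto
  also have "\<dots> = 500"
    using b by (simp add: power2_eq_square eval_nat_numeral)
  finally show ?thesis .
qed

text \<open>The exponent \<open>-5/4\<close> interpolates between the bounded and the quadratically decaying range. Any
  exponent strictly between \<open>-1\<close> and \<open>-3/2\<close> would serve: below \<open>-1\<close> the bounds at the points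
  \<open>m * w\<close> are summable over \<open>m\<close>, and above \<open>-3/2\<close> the error in \<open>log_gf_expansion\<close> vanishes for
  \<open>\<bar>Im w\<bar> = \<bar>s\<bar> * Re w powr (3/2)\<close>.\<close>

lemma inverse_square_minus_exp_bound:
  assumes w: "0 < Re w" "\<bar>Im w\<bar> \<le> Re w"
  shows "norm (1 / w\<^sup>2 - exp w / (exp w - 1)\<^sup>2) \<le> 500 * Re w powr (-5/4)"
proof (cases "Re w \<le> 1")
  case True
  then have "1 powr (-5/4) \<le> Re w powr (-5/4)"
    using w by (intro powr_mono2') auto
  with inverse_square_minus_exp_bound_small[OF w(1) True w(2)] show ?thesis by simp
next
  case False
  then have "9 / (Re w)\<^sup>2 \<le> 9 * Re w powr (-5/4)"
    using powr_mono[of "-2" "-5/4" "Re w"] w by (simp add: powr_minus_divide)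
  also have "\<dots> \<le> 500 * Re w powr (-5/4)" by (intro mult_right_mono) auto
  finally show ?thesis
    using inverse_square_minus_exp_bound_large[of w] False by simp
qed

lemma inverse_exp_minus_one_diff_bound:
  assumes w: "0 < Re w" "\<bar>Im w\<bar> \<le> Re w"
  shows "norm ((1 / (exp w - 1) - 1 / w) - (1 / (exp (of_real (Re w)) - 1) - 1 / of_real (Re w)))
     \<le> 500 * Re w powr (-5/4) * \<bar>Im w\<bar>"
proof -
  let ?x = "of_real (Re w) :: complex"
  let ?S = "closed_segment w ?x"
  have S: "Re z = Re w \<and> \<bar>Im z\<bar> \<le> Re w" if z: "z \<in> ?S" for z
  proof -
    from z obtain u where u: "0 \<le> u" "u \<le> 1" "z = (1 - u) *\<^sub>R w + u *\<^sub>R ?x"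
      by (auto simp: closed_segment_def)
    have "\<bar>Im z\<bar> = (1 - u) * \<bar>Im w\<bar>" using u by (simp add: abs_mult)
    also have "\<dots> \<le> 1 * \<bar>Im w\<bar>" using u by (intro mult_right_mono) auto
    finally have "\<bar>Im z\<bar> \<le> Re w" using w by simp
    moreover have "Re z = Re w" unfolding u(3) by (simp add: algebra_simps)
    ultimately show ?thesis by simp
  qed
  have "norm ((1 / (exp w - 1) - 1 / w) - (1 / (exp ?x - 1) - 1 / ?x))
     \<le> 500 * Re w powr (-5/4) * norm (w - ?x)"
  proof (rule field_differentiable_bound[where f = "\<lambda>z. 1 / (exp z - 1) - 1 / z" and S = ?S])
    fix z assume "z \<in> ?S"
    note z = S[OF this]
    have nz: "z \<noteq> 0" "exp z - 1 \<noteq> 0"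
      using z w norm_exp_minus_one_ge_Re[of z] by auto
    show "((\<lambda>z. 1 / (exp z - 1) - 1 / z) has_field_derivative 1 / z\<^sup>2 - exp z / (exp z - 1)\<^sup>2) (at z within ?S)"
      using nz by (auto intro!: derivative_eq_intros simp: power2_eq_square)
    show "norm (1 / z\<^sup>2 - exp z / (exp z - 1)\<^sup>2) \<le> 500 * Re w powr (-5/4)"
      using inverse_square_minus_exp_bound[of z] z w by auto
  qed auto
  also have "norm (w - ?x) = \<bar>Im w\<bar>"
    by (simp add: cmod_def)
  finally show ?thesis .
qed

text \<open>Replacing \<open>1 / (exp (m * w) - 1)\<close> by \<open>1 / (m * w)\<close> in the series for \<open>log_gf 0\<close> leaves
  \<open>(\<Sum>m\<ge>1. 1 / m\<^sup>2) / w = pi\<^sup>2 / 6 / w\<close>. The error itself grows logarithmically as \<open>w\<close> tends to 0,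
  but its difference between \<open>w\<close> and \<open>Re w\<close> is small.\<close>

lemma log_gf_expansion:
  obtains C where "\<And>w. 0 < Re w \<Longrightarrow> \<bar>Im w\<bar> \<le> Re w \<Longrightarrow>
    norm (log_gf 0 w - log_gf 0 (of_real (Re w)) - of_real (pi\<^sup>2 / 6) * (1 / w - 1 / of_real (Re w)))
      \<le> C * (Re w powr (-5/4) * \<bar>Im w\<bar>)"
proof
  define C where "C = (\<Sum>m. 500 * real (Suc m) powr (-5/4))"
  have "summable (\<lambda>m. real m powr (-5/4))"
    by (simp add: summable_real_powr_iff)
  then have "summable (\<lambda>m. real (Suc m) powr (-5/4))"
    by (subst summable_Suc_iff)
  then have C: "(\<lambda>m. 500 * real (Suc m) powr (-5/4)) sums C"
    unfolding C_def by (intro summable_sums summable_mult)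
  fix w :: complex assume w: "0 < Re w" "\<bar>Im w\<bar> \<le> Re w"
  let ?x = "of_real (Re w) :: complex"
  let ?T = "\<lambda>w m. 1 / (of_nat (Suc m) * (exp (of_nat (Suc m) * w) - 1) :: complex)"
  let ?U = "\<lambda>w m. 1 / (of_nat (Suc m))\<^sup>2 * (1 / w) :: complex"
  have T: "?T w sums log_gf 0 w" if "Re w > 0" for w
    using summable_sums[OF summable_log_gf[OF that, of 0]] by (simp add: log_gf_def del: of_nat_Suc)
  have U: "?U w sums (of_real (pi\<^sup>2 / 6) * (1 / w))" for w
    using sums_mult2[OF sums_of_real[OF inverse_squares_sums], of "1 / w"] by (simp add: add_ac)
  have "(\<lambda>m. ?T w m - ?T ?x m - (?U w m - ?U ?x m)) sums
    (log_gf 0 w - log_gf 0 ?x - (of_real (pi\<^sup>2 / 6) * (1 / w) - of_real (pi\<^sup>2 / 6) * (1 / ?x)))"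
    using w by (intro sums_diff T U) auto
  then have "(\<lambda>m. ?T w m - ?T ?x m - (?U w m - ?U ?x m)) sums
    (log_gf 0 w - log_gf 0 ?x - of_real (pi\<^sup>2 / 6) * (1 / w - 1 / ?x))"
    by (simp only: right_diff_distrib)
  then show "norm (log_gf 0 w - log_gf 0 ?x - of_real (pi\<^sup>2 / 6) * (1 / w - 1 / ?x))
      \<le> C * (Re w powr (-5/4) * \<bar>Im w\<bar>)"
  proof (rule norm_sums_le)
    show "(\<lambda>m. 500 * real (Suc m) powr (-5/4) * (Re w powr (-5/4) * \<bar>Im w\<bar>)) sums
      (C * (Re w powr (-5/4) * \<bar>Im w\<bar>))"
      by (intro sums_mult2 C)
    fix m
    let ?v = "of_nat (Suc m) * w"
    have v: "0 < Re ?v" "\<bar>Im ?v\<bar> \<le> Re ?v"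
      using w by (auto simp: abs_mult simp del: of_nat_Suc)
    have Re_v: "of_real (Re ?v) = of_nat (Suc m) * ?x" by simp
    have alg: "1 / (M * a) - 1 / (M * b) - (1 / M\<^sup>2 * (1 / c) - 1 / M\<^sup>2 * (1 / d))
      = (1 / M) * ((1 / a - 1 / (M * c)) - (1 / b - 1 / (M * d)))" for M a b c d :: complex
      by (simp add: right_diff_distrib power2_eq_square mult.assoc)
    have "?T w m - ?T ?x m - (?U w m - ?U ?x m) = (1 / of_nat (Suc m)) *
      ((1 / (exp ?v - 1) - 1 / ?v) - (1 / (exp (of_real (Re ?v)) - 1) - 1 / of_real (Re ?v)))"
      unfolding Re_v by (rule alg)
    then have "norm (?T w m - ?T ?x m - (?U w m - ?U ?x m)) = (1 / Suc m) *
      norm ((1 / (exp ?v - 1) - 1 / ?v) - (1 / (exp (of_real (Re ?v)) - 1) - 1 / of_real (Re ?v)))"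
      by (simp add: norm_mult norm_divide del: of_nat_Suc)
    also have "\<dots> \<le> (1 / Suc m) * (500 * Re ?v powr (-5/4) * \<bar>Im ?v\<bar>)"
      by (intro mult_left_mono inverse_exp_minus_one_diff_bound v) auto
    also have "\<dots> = 500 * real (Suc m) powr (-5/4) * (Re w powr (-5/4) * \<bar>Im w\<bar>)"
      using w by (simp add: powr_mult abs_mult del: of_nat_Suc)
    finally show "norm (?T w m - ?T ?x m - (?U w m - ?U ?x m))
      \<le> 500 * real (Suc m) powr (-5/4) * (Re w powr (-5/4) * \<bar>Im w\<bar>)" .
  qed
qed

text \<open>The point \<open>x - \<i> * t\<close> of the line of integration with \<open>t = s * x powr (3/2)\<close>, the scale on
  which the integrand is Gaussian.\<close>

definition saddle_arg :: "real \<Rightarrow> real \<Rightarrow> complex" where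
  "saddle_arg x s = Complex x (- (s * x * sqrt x))"

text \<open>With \<open>n = pi\<^sup>2 / (6 * x\<^sup>2)\<close>, the exponent is
  \<open>pi\<^sup>2 / 6 * (1 / w - 1 / x) + n * (w - x) = pi\<^sup>2 / 6 * (w - x)\<^sup>2 / (w * x\<^sup>2)\<close> up to a vanishing error,
  and \<open>(w - x)\<^sup>2 = - s\<^sup>2 * x ^ 3\<close>.\<close>

lemma saddle_tendsto:
  fixes x :: "nat \<Rightarrow> real"
  assumes x: "x \<longlonglongrightarrow> 0" "\<And>n. x n > 0"
  shows "(\<lambda>n. exp (log_gf 0 (saddle_arg (x n) s) - log_gf 0 (of_real (x n))
     + of_real (pi\<^sup>2 / 6 / (x n)\<^sup>2) * (saddle_arg (x n) s - of_real (x n))))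
     \<longlonglongrightarrow> of_real (exp (- (pi\<^sup>2 / 6) * s\<^sup>2))"
proof -
  obtain C where C: "\<And>w. 0 < Re w \<Longrightarrow> \<bar>Im w\<bar> \<le> Re w \<Longrightarrow>
    norm (log_gf 0 w - log_gf 0 (of_real (Re w)) - of_real (pi\<^sup>2 / 6) * (1 / w - 1 / of_real (Re w)))
      \<le> C * (Re w powr (-5/4) * \<bar>Im w\<bar>)"
    using log_gf_expansion by blast
  define w where "w n = saddle_arg (x n) s" for n
  have Re_w: "Re (w n) = x n" and Im_w: "\<bar>Im (w n)\<bar> = \<bar>s\<bar> * x n * sqrt (x n)" for n
    using x(2)[of n] by (auto simp: w_def saddle_arg_def abs_mult)
  have sq: "(\<lambda>n. sqrt (x n)) \<longlonglongrightarrow> 0"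
    using tendsto_real_sqrt[OF x(1)] by simp
  define E where "E n = log_gf 0 (w n) - log_gf 0 (of_real (x n)) - of_real (pi\<^sup>2 / 6) * (1 / w n - 1 / of_real (x n))" for n
  have "E \<longlonglongrightarrow> 0"
  proof (rule Lim_null_comparison)
    have "(\<lambda>n. \<bar>s\<bar> * sqrt (x n)) \<longlonglongrightarrow> \<bar>s\<bar> * 0" by (intro tendsto_intros sq)
    then have "\<forall>\<^sub>F n in sequentially. \<bar>s\<bar> * sqrt (x n) < 1"
      by (rule order_tendstoD) simp
    then show "\<forall>\<^sub>F n in sequentially. norm (E n) \<le> C * \<bar>s\<bar> * x n powr (1/4)"
    proof eventually_elim
      case (elim n)
      have "\<bar>Im (w n)\<bar> \<le> Re (w n)"
        unfolding Re_w Im_w using elim x(2)[of n] mult_left_mono[of "\<bar>s\<bar> * sqrt (x n)" 1 "x n"] by (simp add: mult_ac)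
      with C[of "w n"] have "norm (E n) \<le> C * (x n powr (-5/4) * (\<bar>s\<bar> * x n * sqrt (x n)))"
        unfolding E_def Re_w Im_w using x(2)[of n] by simp
      also have "x n powr (-5/4) * (\<bar>s\<bar> * x n * sqrt (x n)) = \<bar>s\<bar> * (x n powr (-5/4) * x n powr 1 * x n powr (1/2))"
        using x(2)[of n] by (simp add: powr_half_sqrt)
      also have "x n powr (-5/4) * x n powr 1 * x n powr (1/2) = x n powr (1/4)"
        unfolding powr_add[symmetric] by simp
      finally show ?case by (simp add: mult_ac)
    qed
    have "(\<lambda>n. x n powr (1/4)) \<longlonglongrightarrow> 0 powr (1/4)"
      using x(2) by (intro tendsto_powr' x(1)) (auto intro!: always_eventually less_imp_le)
    from tendsto_mult_left[OF this, of "C * \<bar>s\<bar>"]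
    show "(\<lambda>n. C * \<bar>s\<bar> * x n powr (1/4)) \<longlonglongrightarrow> 0" by simp
  qed
  have w_eq: "w n = of_real (x n) * (1 - \<i> * of_real (s * sqrt (x n)))" for n
    by (simp add: w_def saddle_arg_def complex_eq_iff)
  have nz: "w n \<noteq> 0" "x n \<noteq> 0" for n
    using Re_w[of n] x(2)[of n] by (auto simp: complex_eq_iff)
  have "(\<lambda>n. 1 - \<i> * of_real (s * sqrt (x n))) \<longlonglongrightarrow> 1 - \<i> * of_real (s * 0)"
    by (intro tendsto_intros sq)
  then have "(\<lambda>n. w n / of_real (x n)) \<longlonglongrightarrow> 1"
    unfolding w_eq using nz by simp
  from tendsto_divide[OF tendsto_const[of "- of_real (pi\<^sup>2 / 6 * s\<^sup>2)"] this]
  have M: "(\<lambda>n. - of_real (pi\<^sup>2 / 6 * s\<^sup>2) / (w n / of_real (x n))) \<longlonglongrightarrow> - of_real (pi\<^sup>2 / 6 * s\<^sup>2)"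
    by simp
  have eq: "log_gf 0 (w n) - log_gf 0 (of_real (x n)) + of_real (pi\<^sup>2 / 6 / (x n)\<^sup>2) * (w n - of_real (x n))
    = E n + - of_real (pi\<^sup>2 / 6 * s\<^sup>2) / (w n / of_real (x n))" for n
  proof -
    have "w n - of_real (x n) = - \<i> * of_real (s * x n * sqrt (x n))"
      unfolding w_eq by (simp add: algebra_simps)
    then have "(w n - of_real (x n))\<^sup>2 = - of_real ((s * x n * sqrt (x n))\<^sup>2)"
      by (simp add: power_mult_distrib)
    also have "(s * x n * sqrt (x n))\<^sup>2 = s\<^sup>2 * (x n)\<^sup>2 * (sqrt (x n))\<^sup>2"
      by (simp only: power_mult_distrib)
    also have "(sqrt (x n))\<^sup>2 = x n" using x(2)[of n] by simp
    finally have sq: "(w n - of_real (x n))\<^sup>2 = - of_real (s\<^sup>2 * (x n) ^ 3)"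
      by (simp add: power2_eq_square power3_eq_cube mult_ac)
    have "of_real (pi\<^sup>2 / 6) * (1 / w n - 1 / of_real (x n)) + of_real (pi\<^sup>2 / 6 / (x n)\<^sup>2) * (w n - of_real (x n))
      = of_real (pi\<^sup>2 / 6) * ((w n - of_real (x n))\<^sup>2 / (w n * of_real ((x n)\<^sup>2)))"
      using nz[of n] by (simp add: divide_simps) (simp add: power2_eq_square algebra_simps)
    also have "(w n - of_real (x n))\<^sup>2 / (w n * of_real ((x n)\<^sup>2)) = - of_real (s\<^sup>2) / (w n / of_real (x n))"
      unfolding sq using nz[of n] by (simp add: power2_eq_square power3_eq_cube)
    finally show ?thesis unfolding E_def by (simp add: algebra_simps)
  qed
  have "(\<lambda>n. E n + - of_real (pi\<^sup>2 / 6 * s\<^sup>2) / (w n / of_real (x n))) \<longlonglongrightarrow> 0 + - of_real (pi\<^sup>2 / 6 * s\<^sup>2)"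
    by (intro tendsto_add M \<open>E \<longlonglongrightarrow> 0\<close>)
  from tendsto_exp[OF this] show ?thesis
    unfolding eq[symmetric] unfolding w_def by (simp add: exp_of_real[symmetric])
qed

section \<open>Extracting coefficients\<close>

lemma integral_exp_int_mult:
  fixes m :: int
  shows "integrable lborel (\<lambda>t. indicator {-pi..pi} t *\<^sub>R exp (\<i> * of_real (real_of_int m * t)))" (is ?int)
    and "(\<integral>t. indicator {-pi..pi} t *\<^sub>R exp (\<i> * of_real (real_of_int m * t)) \<partial>lborel)
           = (if m = 0 then 2 * pi else 0)" (is ?eq)
proof -
  let ?f = "\<lambda>t::real. exp (\<i> * of_real (real_of_int m * t))"
  define F :: "real \<Rightarrow> complex" where "F = (\<lambda>t. if m = 0 then of_real t else ?f t / (\<i> * of_int m))"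
  have F: "(F has_vector_derivative ?f t) (at t within {-pi..pi})" for t
  proof (cases "m = 0")
    case True
    then show ?thesis unfolding F_def by (auto intro!: derivative_eq_intros)
  next
    case False
    have "((\<lambda>z. exp (a * z) / a) has_field_derivative exp (a * z)) (at z)" if "a \<noteq> 0" for a z :: complex
      using that by (auto intro!: derivative_eq_intros)
    from has_vector_derivative_real_field[OF this[of "\<i> * of_int m" "of_real t"], of "{-pi..pi}"] False
    show ?thesis unfolding F_def by (simp add: mult.assoc)
  qed
  have "has_bochner_integral lborel (\<lambda>t. indicator {-pi..pi} t *\<^sub>R ?f t) (F pi - F (-pi))"
    by (rule has_bochner_integral_FTC_Icc[OF _ F]) (auto intro!: continuous_intros)
  moreover have "F pi - F (-pi) = (if m = 0 then 2 * pi else 0)"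
  proof (cases "m = 0")
    case False
    have "?f pi = ?f (-pi) * exp (\<i> * (of_int m * (of_real pi * 2)))"
      unfolding exp_add[symmetric] by (simp add: algebra_simps)
    then have "?f pi = ?f (-pi)"
      by (subst (asm) exp_eq_1[THEN iffD2]) auto
    with False show ?thesis by (simp add: F_def)
  qed (simp add: F_def)
  ultimately show ?int ?eq
    by (auto simp: has_bochner_integral_iff)
qed

text \<open>Fourier inversion: integrating \<open>exp (n * w)\<close> times the power series term by term over a full
  period leaves only the coefficient of index \<open>n\<close>.\<close>

lemma card_bounded_partitions_integral:
  assumes x: "x > 0"
  shows "of_real (2 * pi) * of_nat (card (bounded_partitions k n)) =
    (\<integral>t. indicator {-pi..pi} t *\<^sub>R
       exp (log_gf 0 (Complex x (-t)) - log_gf k (Complex x (-t)) + of_nat n * Complex x (-t)) \<partial>lborel)"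
proof -
  define a where "a j = card (bounded_partitions k j)" for j
  let ?w = "\<lambda>t. Complex x (-t)"
  define f where "f j t = indicator {-pi..pi} t *\<^sub>R (of_nat (a j) * exp (of_real ((real n - real j) * x)) * exp (\<i> * of_real (real_of_int (int j - int n) * t)))"
    for j t
  have "exp (of_real ((real n - real j) * x)) * exp (\<i> * of_real (real_of_int (int j - int n) * t)) = exp (- ?w t) ^ j * exp (of_nat n * ?w t)" for j t
    unfolding exp_of_nat_mult[symmetric] exp_add[symmetric] by (rule arg_cong[of _ _ exp]) (simp add: complex_eq_iff algebra_simps)
  then have f_eq: "f j t = indicator {-pi..pi} t *\<^sub>R (of_nat (a j) * exp (- ?w t) ^ j * exp (of_nat n * ?w t))" for j t
    unfolding f_def by (simp only: mult.assoc)
  have f_sums: "(\<lambda>j. f j t) sums (indicator {-pi..pi} t *\<^sub>R exp (log_gf 0 (?w t) - log_gf k (?w t) + of_nat n * ?w t))" for t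
  proof -
    have "norm (exp (- ?w t)) < 1" using x by simp
    from sums_bounded_partitions[OF this, of k]
    have "(\<lambda>j. of_nat (a j) * exp (- ?w t) ^ j) sums exp (log_gf 0 (?w t) - log_gf k (?w t))"
      unfolding a_def using x by (simp only: prod_eq_exp_log_gf complex.sel)
    then show ?thesis unfolding f_eq exp_add by (intro sums_scaleR_right sums_mult2)
  qed
  have norm_f: "norm (f j t) = indicator {-pi..pi} t * (exp (real n * x) * (a j * exp (- x) ^ j))" for j t
    unfolding f_eq by (simp add: norm_mult norm_power)
  have summable_a: "summable (\<lambda>j. a j * exp (- x) ^ j)"
    unfolding a_def using x by (intro summable_bounded_partitions) auto
  have "(\<lambda>j. integral\<^sup>L lborel (f j)) sums (\<integral>t. (\<Sum>j. f j t) \<partial>lborel)"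
  proof (rule sums_integral)
    show "integrable lborel (f j)" for j
      unfolding f_def
      using integrable_mult_right[OF integral_exp_int_mult(1)[of "int j - int n"], of "of_nat (a j) * exp (of_real ((real n - real j) * x))"]
      by (simp add: mult_ac)
    show "AE t in lborel. summable (\<lambda>j. norm (f j t))"
      unfolding norm_f by (intro AE_I2 summable_mult summable_a)
    have "(\<integral>t. norm (f j t) \<partial>lborel) = (2 * pi) * (exp (real n * x) * (a j * exp (- x) ^ j))" for j
      unfolding norm_f by simp
    then show "summable (\<lambda>j. \<integral>t. norm (f j t) \<partial>lborel)"
      by (simp only:) (intro summable_mult summable_a)
  qed
  also have "(\<lambda>t. \<Sum>j. f j t) = (\<lambda>t. indicator {-pi..pi} t *\<^sub>R exp (log_gf 0 (?w t) - log_gf k (?w t) + of_nat n * ?w t))"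
    using f_sums by (simp add: sums_iff)
  finally have 1: "(\<lambda>j. integral\<^sup>L lborel (f j)) sums (\<integral>t. indicator {-pi..pi} t *\<^sub>R exp (log_gf 0 (?w t) - log_gf k (?w t) + of_nat n * ?w t) \<partial>lborel)" .
  have int_f: "integral\<^sup>L lborel (f j) = (if j = n then of_real (2 * pi) * of_nat (a n) else 0)" for j
  proof -
    have "integral\<^sup>L lborel (f j) = of_nat (a j) * exp (of_real ((real n - real j) * x)) *
       (\<integral>t. indicator {-pi..pi} t *\<^sub>R exp (\<i> * of_real (real_of_int (int j - int n) * t)) \<partial>lborel)"
      unfolding f_def by (subst integral_mult_right_zero[symmetric]) (simp add: mult_ac)
    then show ?thesis unfolding integral_exp_int_mult(2) by simp
  qed
  have "(\<lambda>j. integral\<^sup>L lborel (f j)) sums (of_real (2 * pi) * of_nat (a n))"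
    unfolding int_f by (rule sums_single)
  with 1 show ?thesis unfolding a_def by (rule sums_unique2[symmetric])
qed

text \<open>The same integral in the scaled variable \<open>s\<close>, normalised by its integrand at the saddle point.
  The coefficient of index \<open>n - d\<close> is expressed at the saddle point for \<open>n\<close>, so that the
  normalising factor does not depend on \<open>d\<close>; the correction is \<open>n - (n - d)\<close> rather than \<open>d\<close>
  because of truncated subtraction.\<close>

lemma card_bounded_partitions_saddle:
  assumes x: "x > 0"
  shows "of_real (2 * pi / (x * sqrt x)) * exp (- log_gf 0 (of_real x) - of_nat n * of_real x) *
      of_nat (card (bounded_partitions k (n - d))) =
    (\<integral>s. indicator {-pi..pi} (x * sqrt x * s) *\<^sub>R
       (exp (log_gf 0 (saddle_arg x s) - log_gf 0 (of_real x) + of_nat n * (saddle_arg x s - of_real x)) *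
        exp (- log_gf k (saddle_arg x s) - of_nat (n - (n - d)) * saddle_arg x s)) \<partial>lborel)"
proof -
  let ?r = "x * sqrt x"
  let ?m = "n - d"
  have r: "?r > 0" using x by simp
  have n: "of_nat n = of_nat ?m + (of_nat (n - ?m) :: complex)"
    by (simp flip: of_nat_add)
  let ?g = "\<lambda>w. exp (log_gf 0 w - log_gf k w + of_nat ?m * w)"
  have "of_real (2 * pi) * of_nat (card (bounded_partitions k ?m)) =
    \<bar>?r\<bar> *\<^sub>R (\<integral>s. indicator {-pi..pi} (?r * s) *\<^sub>R ?g (Complex x (-(?r * s))) \<partial>lborel)"
    unfolding card_bounded_partitions_integral[OF x] using r
    by (subst lborel_integral_real_affine[of ?r _ 0]) auto
  also have "(\<lambda>s. Complex x (-(?r * s))) = saddle_arg x"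
    by (simp add: saddle_arg_def fun_eq_iff mult_ac)
  finally have "of_real (2 * pi / ?r) * of_nat (card (bounded_partitions k ?m)) =
    (\<integral>s. indicator {-pi..pi} (?r * s) *\<^sub>R ?g (saddle_arg x s) \<partial>lborel)"
    using r x by (simp add: scaleR_conv_of_real divide_simps mult_ac)
  then have "exp (- log_gf 0 (of_real x) - of_nat n * of_real x) * (of_real (2 * pi / ?r) * of_nat (card (bounded_partitions k ?m))) =
    (\<integral>s. exp (- log_gf 0 (of_real x) - of_nat n * of_real x) *
       (indicator {-pi..pi} (?r * s) *\<^sub>R ?g (saddle_arg x s)) \<partial>lborel)"
    by (simp only: integral_mult_right_zero)
  also have "(\<lambda>s. exp (- log_gf 0 (of_real x) - of_nat n * of_real x) *
       (indicator {-pi..pi} (?r * s) *\<^sub>R ?g (saddle_arg x s))) =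
    (\<lambda>s. indicator {-pi..pi} (?r * s) *\<^sub>R
       (exp (log_gf 0 (saddle_arg x s) - log_gf 0 (of_real x) + of_nat n * (saddle_arg x s - of_real x)) *
        exp (- log_gf k (saddle_arg x s) - of_nat (n - ?m) * saddle_arg x s)))"
    unfolding mult_scaleR_right exp_add[symmetric] n
    by (intro ext arg_cong[of _ _ "\<lambda>z. _ *\<^sub>R exp z"]) (simp add: algebra_simps)
  finally show ?thesis by (simp only: mult_ac)
qed

text \<open>Dominated convergence. The choice of \<open>x\<close> makes \<open>n = pi\<^sup>2 / (6 * x\<^sup>2)\<close>, as in
  \<open>saddle_tendsto\<close>, and the hypothesis \<open>bounded\<close> bounds \<open>log_gf (K n)\<close> along the whole line. The
  normalising factor and the Gaussian integral depend neither on \<open>K\<close> nor on \<open>d\<close>.\<close>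

lemma scaled_card_bounded_partitions_tendsto:
  fixes K :: "nat \<Rightarrow> nat" and l :: complex and x :: "nat \<Rightarrow> real"
  defines "x \<equiv> \<lambda>n. pi / sqrt 6 / sqrt (real n)"
  assumes lim: "\<And>s. (\<lambda>n. log_gf (K n) (saddle_arg (x n) s)) \<longlonglongrightarrow> l"
    and bounded: "\<forall>\<^sub>F n in sequentially. exp (- (real (K n) * x n)) / x n \<le> B"
  shows "(\<lambda>n. of_real (2 * pi / (x n * sqrt (x n))) * exp (- log_gf 0 (of_real (x n)) - of_nat n * of_real (x n)) *
      of_nat (card (bounded_partitions (K n) (n - d))))
    \<longlonglongrightarrow> exp (- l) * of_real (\<integral>s. exp (- (pi\<^sup>2 / 6) * s\<^sup>2) \<partial>lborel)"
proof -
  define f where "f n s = indicator {-pi..pi} (x n * sqrt (x n) * s) *\<^sub>R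
       (exp (log_gf 0 (saddle_arg (x n) s) - log_gf 0 (of_real (x n)) + of_nat n * (saddle_arg (x n) s - of_real (x n))) *
        exp (- log_gf (K n) (saddle_arg (x n) s) - of_nat (n - (n - d)) * saddle_arg (x n) s))" for n s
  have x_lim: "x \<longlonglongrightarrow> 0"
    unfolding x_def by real_asymp
  have x_pos: "x n > 0" if "n > 0" for n
    using that by (simp add: x_def)
  have x_sq: "real n = pi\<^sup>2 / 6 / (x n)\<^sup>2" if "n > 0" for n
    using that by (simp add: x_def power_divide power_mult_distrib)
  have Re_saddle: "Re (saddle_arg (x n) s) = x n" for n s
    by (simp add: saddle_arg_def)
  have saddle_0: "(\<lambda>n. saddle_arg (x n) s) \<longlonglongrightarrow> 0" for s
  proof -
    have "(\<lambda>n. Complex (x n) (- (s * x n * sqrt (x n)))) \<longlonglongrightarrow> Complex 0 (- (s * 0 * sqrt 0))"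
      by (intro tendsto_intros x_lim)
    then show ?thesis by (simp add: saddle_arg_def zero_complex.code)
  qed
  define w :: "real \<Rightarrow> real" where "w s = 20000000 * exp (B * (pi\<^sup>2 / 6)) * inverse (1 + s\<^sup>2)" for s
  have "\<forall>\<^sub>F n in sequentially. x n < 1"
    using x_lim by (rule order_tendstoD) simp
  then have "\<forall>\<^sub>F n in sequentially. n > 0 \<and> x n < 1 \<and> exp (- (real (K n) * x n)) / x n \<le> B"
    by (intro eventually_conj bounded eventually_gt_at_top)
  then obtain N where "\<forall>n\<ge>N. n > 0 \<and> x n < 1 \<and> exp (- (real (K n) * x n)) / x n \<le> B"
    unfolding eventually_sequentially by blast
  then have N: "n > 0" "x n \<le> 1" "exp (- (real (K n) * x n)) / x n \<le> B" if "n \<ge> N" for n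
    using that by auto
  have f_bound: "norm (f n s) \<le> w s" if n: "n \<ge> N" for n s
  proof (cases "\<bar>x n * sqrt (x n) * s\<bar> \<le> pi")
    case False
    then show ?thesis by (auto simp: f_def w_def indicator_def)
  next
    case True
    let ?w = "saddle_arg (x n) s"
    have w_pos: "Re ?w > 0" using x_pos[OF N(1)[OF n]] by (simp add: Re_saddle)
    have "norm (exp (log_gf 0 ?w - log_gf 0 (of_real (x n)) + of_nat n * (?w - of_real (x n))))
       = norm (exp (log_gf 0 ?w - log_gf 0 (of_real (x n))))"
      by (simp add: Re_saddle)
    also have "\<dots> \<le> 20000000 / (1 + s\<^sup>2)"
      unfolding saddle_arg_def
    proof (rule norm_exp_log_gf_le)
      show "(- (s * x n * sqrt (x n)))\<^sup>2 = s\<^sup>2 * x n ^ 3"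
        using x_pos[OF N(1)[OF n]] by (simp add: power_mult_distrib power2_eq_square power3_eq_cube)
    qed (use N[OF n] x_pos True in \<open>auto simp: mult_ac\<close>)
    finally have 1: "norm (exp (log_gf 0 ?w - log_gf 0 (of_real (x n)) + of_nat n * (?w - of_real (x n))))
       \<le> 20000000 * inverse (1 + s\<^sup>2)" by (simp add: divide_inverse)
    have "norm (log_gf (K n) ?w) \<le> B * (pi\<^sup>2 / 6)"
      using norm_log_gf_le[OF w_pos, of "K n"] mult_right_mono[OF N(3)[OF n], of "pi\<^sup>2 / 6"]
      unfolding Re_saddle by simp
    moreover have "0 \<le> real (n - (n - d)) * Re ?w"
      using w_pos by (intro mult_nonneg_nonneg) auto
    moreover have "Re (- log_gf (K n) ?w - of_nat (n - (n - d)) * ?w) = - Re (log_gf (K n) ?w) - real (n - (n - d)) * Re ?w"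
      by simp
    moreover note abs_Re_le_cmod[of "log_gf (K n) ?w"]
    ultimately have 2: "norm (exp (- log_gf (K n) ?w - of_nat (n - (n - d)) * ?w)) \<le> exp (B * (pi\<^sup>2 / 6))"
      unfolding norm_exp_eq_Re exp_le_cancel_iff by linarith
    have "norm (f n s) \<le> 20000000 * inverse (1 + s\<^sup>2) * exp (B * (pi\<^sup>2 / 6))"
      using mult_mono[OF 1 2] by (auto simp: f_def norm_mult indicator_def)
    then show ?thesis by (simp add: w_def mult_ac)
  qed
  have f_lim: "(\<lambda>n. f n s) \<longlonglongrightarrow> of_real (exp (- (pi\<^sup>2 / 6) * s\<^sup>2)) * exp (- l)" for s
  proof -
    have "(\<lambda>n. \<bar>x n * sqrt (x n) * s\<bar>) \<longlonglongrightarrow> \<bar>0 * sqrt 0 * s\<bar>"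
      by (intro tendsto_intros x_lim)
    then have "\<forall>\<^sub>F n in sequentially. \<bar>x n * sqrt (x n) * s\<bar> < pi"
      by (rule order_tendstoD) simp
    then have ind: "\<forall>\<^sub>F n in sequentially. indicator {-pi..pi} (x n * sqrt (x n) * s) = (1::real)"
      by eventually_elim (auto simp: indicator_def)
    have "(\<lambda>n. exp (log_gf 0 (saddle_arg (x (Suc n)) s) - log_gf 0 (of_real (x (Suc n)))
         + of_real (pi\<^sup>2 / 6 / (x (Suc n))\<^sup>2) * (saddle_arg (x (Suc n)) s - of_real (x (Suc n)))))
       \<longlonglongrightarrow> of_real (exp (- (pi\<^sup>2 / 6) * s\<^sup>2))"
      by (rule saddle_tendsto) (auto intro: x_pos LIMSEQ_Suc x_lim)
    then have "(\<lambda>n. exp (log_gf 0 (saddle_arg (x (Suc n)) s) - log_gf 0 (of_real (x (Suc n)))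
         + of_nat (Suc n) * (saddle_arg (x (Suc n)) s - of_real (x (Suc n)))))
       \<longlonglongrightarrow> of_real (exp (- (pi\<^sup>2 / 6) * s\<^sup>2))"
      by (simp only: x_sq[OF zero_less_Suc, symmetric] of_real_of_nat_eq)
    then have 1: "(\<lambda>n. exp (log_gf 0 (saddle_arg (x n) s) - log_gf 0 (of_real (x n))
         + of_nat n * (saddle_arg (x n) s - of_real (x n))))
       \<longlonglongrightarrow> of_real (exp (- (pi\<^sup>2 / 6) * s\<^sup>2))"
      by (rule LIMSEQ_imp_Suc)
    have "(\<lambda>n. of_nat d * saddle_arg (x n) s) \<longlonglongrightarrow> of_nat d * 0"
      by (intro tendsto_intros saddle_0)
    moreover have "\<forall>\<^sub>F n in sequentially. of_nat d * saddle_arg (x n) s = of_nat (n - (n - d)) * saddle_arg (x n) s"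
      using eventually_ge_at_top[of d] by eventually_elim simp
    ultimately have "(\<lambda>n. of_nat (n - (n - d)) * saddle_arg (x n) s) \<longlonglongrightarrow> of_nat d * 0"
      by (rule Lim_transform_eventually)
    note shift = this
    have "(\<lambda>n. exp (- log_gf (K n) (saddle_arg (x n) s) - of_nat (n - (n - d)) * saddle_arg (x n) s)) \<longlonglongrightarrow> exp (- l - of_nat d * 0)"
      by (intro tendsto_exp tendsto_diff tendsto_minus lim shift)
    from tendsto_scaleR[OF tendsto_eventually[OF ind] tendsto_mult[OF 1 this]]
    show ?thesis unfolding f_def by simp
  qed
  have meas: "f n \<in> borel_measurable borel" for n
  proof -
    have "saddle_arg (x n) = (\<lambda>s. of_real (x n) - \<i> * of_real (s * x n * sqrt (x n)))"
      by (simp add: fun_eq_iff saddle_arg_def complex_eq_iff)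
    then have [measurable]: "saddle_arg (x n) \<in> borel_measurable borel" by simp
    show ?thesis unfolding f_def by measurable
  qed
  have "(\<lambda>n. integral\<^sup>L lborel (f n)) \<longlonglongrightarrow> (\<integral>s. of_real (exp (- (pi\<^sup>2 / 6) * s\<^sup>2)) * exp (- l) \<partial>lborel)"
  proof (rule LIMSEQ_offset[of _ N], rule integral_dominated_convergence)
    have "integrable lborel (\<lambda>s::real. inverse (1 + s\<^sup>2))"
      using integrable_inverse_1_plus_square by (simp add: set_integrable_def)
    then show "integrable lborel w" unfolding w_def by simp
    show "AE s in lborel. (\<lambda>n. f (n + N) s) \<longlonglongrightarrow> of_real (exp (- (pi\<^sup>2 / 6) * s\<^sup>2)) * exp (- l)"
      by (intro AE_I2 LIMSEQ_ignore_initial_segment f_lim)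
    show "AE s in lborel. norm (f (n + N) s) \<le> w s" for n
      by (intro AE_I2 f_bound) simp
  qed (auto intro: meas)
  also have "(\<integral>s. of_real (exp (- (pi\<^sup>2 / 6) * s\<^sup>2)) * exp (- l) \<partial>lborel) = exp (- l) * of_real (\<integral>s. exp (- (pi\<^sup>2 / 6) * s\<^sup>2) \<partial>lborel)"
    unfolding integral_mult_left_zero integral_complex_of_real by (rule mult.commute)
  finally have lim_int: "(\<lambda>n. integral\<^sup>L lborel (f n)) \<longlonglongrightarrow> exp (- l) * of_real (\<integral>s. exp (- (pi\<^sup>2 / 6) * s\<^sup>2) \<partial>lborel)" .
  show ?thesis
  proof (rule Lim_transform_eventually[OF lim_int])
    show "\<forall>\<^sub>F n in sequentially. integral\<^sup>L lborel (f n) = of_real (2 * pi / (x n * sqrt (x n))) *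
        exp (- log_gf 0 (of_real (x n)) - of_nat n * of_real (x n)) *
        of_nat (card (bounded_partitions (K n) (n - d)))"
      using eventually_gt_at_top[of 0]
      by eventually_elim (simp only: card_bounded_partitions_saddle[OF x_pos] f_def[abs_def])
  qed
qed

lemma gaussian_integral_pos: "(\<integral>s. exp (- (pi\<^sup>2 / 6) * s\<^sup>2) \<partial>lborel) > 0"
proof -
  define \<sigma> where "\<sigma> = sqrt 3 / pi"
  have \<sigma>: "\<sigma> > 0" by (simp add: \<sigma>_def)
  have "pi\<^sup>2 / 6 = 1 / (2 * \<sigma>\<^sup>2)" by (simp add: \<sigma>_def power_divide)
  then have "- (pi\<^sup>2 / 6) * s\<^sup>2 = - (s - 0)\<^sup>2 / (2 * \<sigma>\<^sup>2)" for s by simp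
  then have "(\<lambda>s. exp (- (pi\<^sup>2 / 6) * s\<^sup>2)) = (\<lambda>s. sqrt (2 * pi * \<sigma>\<^sup>2) * normal_density 0 \<sigma> s)"
    using \<sigma> by (simp add: normal_density_def del: real_sqrt_mult)
  then show ?thesis using \<sigma> by simp
qed

section \<open>Ratios of coefficients\<close>

text \<open>For \<open>k = n\<close> there is no restriction on the parts, and \<open>log_gf n\<close> is negligible.\<close>

lemma log_gf_self_tendsto:
  "(\<lambda>n. log_gf n (saddle_arg (pi / sqrt 6 / sqrt (real n)) s)) \<longlonglongrightarrow> 0"
proof -
  define x where "x n = pi / sqrt 6 / sqrt (real n)" for n
  have "(\<lambda>n. exp (- (real n * x n)) / x n * (pi\<^sup>2 / 6)) \<longlonglongrightarrow> 0"
    unfolding x_def by real_asymp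
  then have "(\<lambda>n. log_gf n (saddle_arg (x n) s)) \<longlonglongrightarrow> 0"
  proof (rule Lim_null_comparison[rotated])
    show "\<forall>\<^sub>F n in sequentially. norm (log_gf n (saddle_arg (x n) s)) \<le> exp (- (real n * x n)) / x n * (pi\<^sup>2 / 6)"
      using eventually_gt_at_top[of 0]
    proof eventually_elim
      case (elim n)
      then have "Re (saddle_arg (x n) s) = x n" "x n > 0" by (simp_all add: saddle_arg_def x_def)
      with norm_log_gf_le[of "saddle_arg (x n) s" n] show ?case by simp
    qed
  qed
  then show ?thesis unfolding x_def .
qed

lemma log_gf_self_bounded:
  "\<forall>\<^sub>F n in sequentially. exp (- (real n * (pi / sqrt 6 / sqrt (real n)))) / (pi / sqrt 6 / sqrt (real n)) \<le> 1"
  by real_asymp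

lemma card_bounded_partitions_ratio_tendsto:
  fixes K :: "nat \<Rightarrow> nat" and l :: real
  assumes lim: "\<And>s. (\<lambda>n. log_gf (K n) (saddle_arg (pi / sqrt 6 / sqrt (real n)) s)) \<longlonglongrightarrow> of_real l"
    and bounded: "\<forall>\<^sub>F n in sequentially.
      exp (- (real (K n) * (pi / sqrt 6 / sqrt (real n)))) / (pi / sqrt 6 / sqrt (real n)) \<le> B"
  shows "(\<lambda>n. card (bounded_partitions (K n) (n - d)) / card (bounded_partitions n n)) \<longlonglongrightarrow> exp (- l)"
proof -
  define x where "x n = pi / sqrt 6 / sqrt (real n)" for n
  define A where "A n = of_real (2 * pi / (x n * sqrt (x n))) * exp (- log_gf 0 (of_real (x n)) - of_nat n * of_real (x n))" for n
  define J where "J = (\<integral>s. exp (- (pi\<^sup>2 / 6) * s\<^sup>2) \<partial>lborel)"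
  have x_pos: "x n > 0" if "n > 0" for n using that by (simp add: x_def)
  have num: "(\<lambda>n. A n * of_nat (card (bounded_partitions (K n) (n - d)))) \<longlonglongrightarrow> exp (- of_real l) * of_real J"
    unfolding A_def J_def x_def by (rule scaled_card_bounded_partitions_tendsto[OF lim bounded])
  have "(\<lambda>n. A n * of_nat (card (bounded_partitions n (n - 0)))) \<longlonglongrightarrow> exp (- 0) * of_real J"
    unfolding A_def J_def x_def
    by (rule scaled_card_bounded_partitions_tendsto[OF log_gf_self_tendsto log_gf_self_bounded])
  then have den: "(\<lambda>n. A n * of_nat (card (bounded_partitions n n))) \<longlonglongrightarrow> of_real J" by simp
  have J: "J > 0" unfolding J_def by (rule gaussian_integral_pos)
  have "(\<lambda>n. A n * of_nat (card (bounded_partitions (K n) (n - d))) / (A n * of_nat (card (bounded_partitions n n))))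
     \<longlonglongrightarrow> exp (- of_real l) * of_real J / of_real J"
    using J by (intro tendsto_divide num den) simp
  also have "exp (- of_real l) * of_real J / of_real J = (of_real (exp (- l)) :: complex)"
    using J by (simp add: exp_of_real[symmetric])
  finally have lim_A: "(\<lambda>n. A n * of_nat (card (bounded_partitions (K n) (n - d))) / (A n * of_nat (card (bounded_partitions n n))))
     \<longlonglongrightarrow> of_real (exp (- l))" .
  have "(\<lambda>n. of_real (card (bounded_partitions (K n) (n - d)) / card (bounded_partitions n n)) :: complex) \<longlonglongrightarrow> of_real (exp (- l))"
  proof (rule Lim_transform_eventually[OF lim_A])
    show "\<forall>\<^sub>F n in sequentially. A n * of_nat (card (bounded_partitions (K n) (n - d))) / (A n * of_nat (card (bounded_partitions n n)))
      = of_real (card (bounded_partitions (K n) (n - d)) / card (bounded_partitions n n))"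
      using eventually_gt_at_top[of 0]
    proof eventually_elim
      case (elim n)
      have "A n \<noteq> 0" using x_pos[OF elim] by (simp add: A_def)
      then show ?case by simp
    qed
  qed
  then show ?thesis by (simp only: tendsto_of_real_iff)
qed

text \<open>If \<open>k\<close> is so large that \<open>exp (- k * Re w)\<close> is of the order of \<open>Re w\<close>, then only the first term
  of the series for \<open>log_gf k\<close> matters.\<close>

lemma norm_log_gf_minus_first_le:
  assumes w: "Re w > 0"
  shows "norm (log_gf k w - exp (- (of_nat k * w)) / (exp w - 1)) \<le> (exp (- (real k * Re w)))\<^sup>2 / Re w * (pi\<^sup>2 / 6)"
proof -
  let ?T = "\<lambda>m. exp (- (of_nat (Suc m) * of_nat k * w)) / (of_nat (Suc m) * (exp (of_nat (Suc m) * w) - 1))"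
  let ?q = "exp (- (real k * Re w))"
  have "?T sums log_gf k w"
    unfolding log_gf_def using w by (intro summable_sums summable_log_gf)
  then have "(\<lambda>m. ?T (Suc m)) sums (log_gf k w - ?T 0)"
    using sums_Suc_iff[of ?T "log_gf k w - ?T 0"] by simp
  then have "(\<lambda>m. ?T (Suc m)) sums (log_gf k w - exp (- (of_nat k * w)) / (exp w - 1))"
    by (simp del: of_nat_Suc add: of_nat_Suc[of 0])
  then show ?thesis
  proof (rule norm_sums_le)
    show "(\<lambda>m. ?q\<^sup>2 / Re w * (1 / (real m + 1)\<^sup>2)) sums (?q\<^sup>2 / Re w * (pi\<^sup>2 / 6))"
      using inverse_squares_sums by (intro sums_mult) (simp add: add_ac)
    fix m
    have "?q ^ Suc (Suc m) \<le> ?q ^ 2"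
      using w by (intro power_decreasing) auto
    moreover have "1 / (real (Suc m) + 1)\<^sup>2 \<le> 1 / (real m + 1)\<^sup>2"
      by (intro divide_left_mono power_mono) auto
    ultimately have "?q ^ Suc (Suc m) / Re w * (1 / (real (Suc m) + 1)\<^sup>2)
      \<le> ?q\<^sup>2 / Re w * (1 / (real m + 1)\<^sup>2)"
      using w by (intro mult_mono divide_right_mono) auto
    with norm_log_gf_term_le[OF w, of "Suc m" k]
    show "norm (?T (Suc m)) \<le> ?q\<^sup>2 / Re w * (1 / (real m + 1)\<^sup>2)" by linarith
  qed
qed

text \<open>The hypothesis \<open>K n * x n * sqrt (x n) \<longlonglongrightarrow> 0\<close> says that the phase of \<open>exp (- K n * w)\<close> is
  negligible; the factor \<open>1 / (exp w - 1)\<close> contributes \<open>1 / x n\<close>.\<close>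

lemma log_gf_tendsto:
  fixes x :: "nat \<Rightarrow> real" and K :: "nat \<Rightarrow> nat"
  assumes x: "x \<longlonglongrightarrow> 0" "\<forall>\<^sub>F n in sequentially. x n > 0"
    and e: "(\<lambda>n. exp (- (real (K n) * x n)) / x n) \<longlonglongrightarrow> l"
    and K: "(\<lambda>n. real (K n) * x n * sqrt (x n)) \<longlonglongrightarrow> 0"
  shows "(\<lambda>n. log_gf (K n) (saddle_arg (x n) s)) \<longlonglongrightarrow> of_real l"
proof -
  define w where "w n = saddle_arg (x n) s" for n
  have Re_w: "Re (w n) = x n" for n by (simp add: w_def saddle_arg_def)
  have sq: "(\<lambda>n. sqrt (x n)) \<longlonglongrightarrow> 0"
    using tendsto_real_sqrt[OF x(1)] by simp
  have w_eq: "w n = of_real (x n) * (1 - \<i> * of_real (s * sqrt (x n)))" for n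
    by (simp add: w_def saddle_arg_def complex_eq_iff)
  have v: "(\<lambda>n. 1 - \<i> * of_real (s * sqrt (x n))) \<longlonglongrightarrow> 1 - \<i> * of_real (s * 0)"
    by (intro tendsto_intros sq)
  have "w \<longlonglongrightarrow> of_real 0 * (1 - \<i> * of_real (s * 0))"
    unfolding w_eq by (intro tendsto_mult v tendsto_of_real x)
  then have w_0: "w \<longlonglongrightarrow> 0" by simp
  have w_nz: "\<forall>\<^sub>F n in sequentially. w n \<noteq> 0"
    using x(2) by eventually_elim (metis Re_w zero_complex.sel(1) less_irrefl)
  have "filterlim w (at 0) sequentially"
    using w_0 w_nz by (simp add: filterlim_at)
  then have lim1: "(\<lambda>n. (exp (w n) - 1) / w n) \<longlonglongrightarrow> 1"
    by (rule filterlim_compose[OF lim_exp_minus_1])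
  have "(\<lambda>n. exp (\<i> * of_real (s * (real (K n) * x n * sqrt (x n))))) \<longlonglongrightarrow> exp (\<i> * of_real (s * 0))"
    by (intro tendsto_intros K)
  then have lim2: "(\<lambda>n. exp (\<i> * of_real (s * (real (K n) * x n * sqrt (x n))))) \<longlonglongrightarrow> 1" by simp
  \<comment> \<open>The first term of the series, factored into quantities whose limits are known.\<close>
  have "(\<lambda>n. of_real (exp (- (real (K n) * x n)) / x n) * exp (\<i> * of_real (s * (real (K n) * x n * sqrt (x n))))
      / (1 - \<i> * of_real (s * sqrt (x n))) / ((exp (w n) - 1) / w n)) \<longlonglongrightarrow>
     of_real l * 1 / (1 - \<i> * of_real (s * 0)) / 1"
    by (intro tendsto_divide tendsto_mult tendsto_of_real e lim2 v lim1) auto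
  then have first': "(\<lambda>n. of_real (exp (- (real (K n) * x n)) / x n) * exp (\<i> * of_real (s * (real (K n) * x n * sqrt (x n))))
      / (1 - \<i> * of_real (s * sqrt (x n))) / ((exp (w n) - 1) / w n)) \<longlonglongrightarrow> of_real l"
    by simp
  have first: "(\<lambda>n. exp (- (of_nat (K n) * w n)) / (exp (w n) - 1)) \<longlonglongrightarrow> of_real l"
  proof (rule Lim_transform_eventually[OF first'])
    show "\<forall>\<^sub>F n in sequentially. of_real (exp (- (real (K n) * x n)) / x n) * exp (\<i> * of_real (s * (real (K n) * x n * sqrt (x n))))
      / (1 - \<i> * of_real (s * sqrt (x n))) / ((exp (w n) - 1) / w n) = exp (- (of_nat (K n) * w n)) / (exp (w n) - 1)"
      using x(2) w_nz
    proof eventually_elim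
      case (elim n)
      have "of_real (exp (- (real (K n) * x n))) * exp (\<i> * of_real (s * (real (K n) * x n * sqrt (x n)))) = exp (- (of_nat (K n) * w n))"
        unfolding exp_of_real[symmetric] exp_add[symmetric] w_eq by (simp add: algebra_simps)
      moreover have "of_real (a / x n) * b / v / ((c - 1) / (of_real (x n) * v)) = of_real a * b / (c - 1)"
        if "v \<noteq> 0" for a :: real and b c v :: complex
        using elim(1) that by simp
      moreover have "1 - \<i> * of_real (s * sqrt (x n)) \<noteq> 0"
        using elim(2) unfolding w_eq by auto
      ultimately show ?case unfolding w_eq[of n] by metis
    qed
  qed
  have "(\<lambda>n. exp (- (real (K n) * x n)) / x n * (exp (- (real (K n) * x n)) / x n) * x n * (pi\<^sup>2 / 6)) \<longlonglongrightarrow> l * l * 0 * (pi\<^sup>2 / 6)"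
    by (intro tendsto_intros e x)
  then have rest_bound: "(\<lambda>n. exp (- (real (K n) * x n)) / x n * (exp (- (real (K n) * x n)) / x n) * x n * (pi\<^sup>2 / 6)) \<longlonglongrightarrow> 0"
    by simp
  have "(\<lambda>n. log_gf (K n) (w n) - exp (- (of_nat (K n) * w n)) / (exp (w n) - 1)) \<longlonglongrightarrow> 0"
  proof (rule Lim_null_comparison[OF _ rest_bound])
    show "\<forall>\<^sub>F n in sequentially. norm (log_gf (K n) (w n) - exp (- (of_nat (K n) * w n)) / (exp (w n) - 1))
      \<le> exp (- (real (K n) * x n)) / x n * (exp (- (real (K n) * x n)) / x n) * x n * (pi\<^sup>2 / 6)"
      using x(2)
    proof eventually_elim
      case (elim n)
      with norm_log_gf_minus_first_le[of "w n" "K n"] show ?case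
        unfolding Re_w by (simp add: power2_eq_square)
    qed
  qed
  from tendsto_add[OF this first] show ?thesis unfolding w_def by simp
qed

section \<open>The limit law\<close>

text \<open>The hypotheses of \<open>log_gf_tendsto\<close> for the threshold of the limit law. Here \<open>K n * c / sqrt n\<close>
  is \<open>ln n / 2 + c * u\<close> up to a vanishing rounding error, and \<open>exp (- ln n / 2)\<close> cancels the factor
  \<open>sqrt n\<close>.\<close>

lemma Gumbel_threshold:
  fixes c u :: real
  assumes c: "c > 0"
  defines "K \<equiv> \<lambda>n. nat \<lfloor>sqrt (real n) * (ln (real n) / (2 * c) + u)\<rfloor>"
  shows "(\<lambda>n. exp (- (real (K n) * (c / sqrt (real n)))) / (c / sqrt (real n))) \<longlonglongrightarrow> exp (- c * u) / c"
    and "(\<lambda>n. real (K n) * (c / sqrt (real n)) * sqrt (c / sqrt (real n))) \<longlonglongrightarrow> 0"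
proof -
  define y where "y n = sqrt (real n) * (ln (real n) / (2 * c) + u)" for n
  define x where "x n = c / sqrt (real n)" for n
  define \<delta> where "\<delta> n = real (K n) * x n - (ln (real n) / 2 + c * u)" for n
  have x_0: "x \<longlonglongrightarrow> 0" unfolding x_def using c by real_asymp
  have "filterlim y at_top sequentially" unfolding y_def using c by real_asymp
  then have y_pos: "\<forall>\<^sub>F n in sequentially. y n \<ge> 0"
    by (simp add: filterlim_at_top)
  have \<delta>_0: "\<delta> \<longlonglongrightarrow> 0"
  proof (rule Lim_null_comparison[OF _ x_0])
    show "\<forall>\<^sub>F n in sequentially. norm (\<delta> n) \<le> x n"
      using y_pos eventually_gt_at_top[of 0]
    proof eventually_elim
      case (elim n)
      have "\<bar>real (K n) - y n\<bar> \<le> 1"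
        using elim(1) unfolding K_def y_def[symmetric] by (simp add: abs_le_iff) linarith
      moreover have "x n > 0" using elim c by (simp add: x_def)
      ultimately have "\<bar>real (K n) - y n\<bar> * x n \<le> 1 * x n" by (intro mult_right_mono) auto
      moreover have "\<delta> n = (real (K n) - y n) * x n"
        using elim c unfolding \<delta>_def y_def x_def by (simp add: field_simps)
      ultimately show ?case using \<open>x n > 0\<close> by (simp add: abs_mult)
    qed
  qed
  have Kx: "real (K n) * x n = ln (real n) / 2 + c * u + \<delta> n" for n
    by (simp add: \<delta>_def)
  have "(\<lambda>n. exp (- \<delta> n) * (exp (- c * u) / c)) \<longlonglongrightarrow> exp (- 0) * (exp (- c * u) / c)"
    by (intro tendsto_intros \<delta>_0)
  then have 1: "(\<lambda>n. exp (- \<delta> n) * (exp (- c * u) / c)) \<longlonglongrightarrow> exp (- c * u) / c" by simp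
  have "(\<lambda>n. exp (- (real (K n) * x n)) / x n) \<longlonglongrightarrow> exp (- c * u) / c"
  proof (rule Lim_transform_eventually[OF 1])
    show "\<forall>\<^sub>F n in sequentially. exp (- \<delta> n) * (exp (- c * u) / c) = exp (- (real (K n) * x n)) / x n"
      using eventually_gt_at_top[of 0]
    proof eventually_elim
      case (elim n)
      have "exp (- (real (K n) * x n)) = exp (- (ln (real n) / 2)) * exp (- c * u) * exp (- \<delta> n)"
        unfolding Kx exp_add[symmetric] by simp
      also have "exp (- (ln (real n) / 2)) = 1 / sqrt (real n)"
        using elim by (simp add: exp_minus inverse_eq_divide ln_sqrt[symmetric])
      finally show ?case using elim c by (simp add: x_def)
    qed
  qed
  then show "(\<lambda>n. exp (- (real (K n) * (c / sqrt (real n)))) / (c / sqrt (real n))) \<longlonglongrightarrow> exp (- c * u) / c"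
    unfolding x_def .
  have "(\<lambda>n. (ln (real n) / 2 + c * u) * sqrt (x n)) \<longlonglongrightarrow> 0"
    unfolding x_def using c by real_asymp
  moreover have "(\<lambda>n. \<delta> n * sqrt (x n)) \<longlonglongrightarrow> 0 * sqrt 0"
    by (intro tendsto_intros \<delta>_0 x_0)
  ultimately have "(\<lambda>n. (ln (real n) / 2 + c * u) * sqrt (x n) + \<delta> n * sqrt (x n)) \<longlonglongrightarrow> 0 + 0 * sqrt 0"
    by (rule tendsto_add)
  then have "(\<lambda>n. real (K n) * x n * sqrt (x n)) \<longlonglongrightarrow> 0"
    unfolding Kx by (simp add: distrib_right)
  then show "(\<lambda>n. real (K n) * (c / sqrt (real n)) * sqrt (c / sqrt (real n))) \<longlonglongrightarrow> 0"
    unfolding x_def .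
qed

text \<open>The Gumbel limit law for the largest part (Erdos and Lehner).\<close>

lemma largest_part_limit:
  fixes c u :: real
  assumes c: "c = pi / sqrt 6"
  defines "K \<equiv> \<lambda>n. nat \<lfloor>sqrt (real n) * (ln (real n) / (2 * c) + u)\<rfloor>"
  shows "(\<lambda>n. card {ps \<in> int_partitions n. largest_part ps \<le> K n} / card (int_partitions n)) \<longlonglongrightarrow>
     exp (- (1 / c) * exp (- c * u))"
proof -
  have c_pos: "c > 0" by (simp add: c)
  have th: "(\<lambda>n. exp (- (real (K n) * (c / sqrt (real n)))) / (c / sqrt (real n))) \<longlonglongrightarrow> exp (- c * u) / c"
    "(\<lambda>n. real (K n) * (c / sqrt (real n)) * sqrt (c / sqrt (real n))) \<longlonglongrightarrow> 0"
    unfolding K_def by (rule Gumbel_threshold[OF c_pos])+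
  have "(\<lambda>n. card (bounded_partitions (K n) (n - 0)) / card (bounded_partitions n n)) \<longlonglongrightarrow> exp (- (exp (- c * u) / c))"
  proof (rule card_bounded_partitions_ratio_tendsto[folded c])
    show "(\<lambda>n. log_gf (K n) (saddle_arg (c / sqrt (real n)) s)) \<longlonglongrightarrow> of_real (exp (- c * u) / c)" for s
    proof (rule log_gf_tendsto[OF _ _ th])
      show "(\<lambda>n. c / sqrt (real n)) \<longlonglongrightarrow> 0" by real_asymp
      show "\<forall>\<^sub>F n in sequentially. c / sqrt (real n) > 0"
        using eventually_gt_at_top[of 0] by eventually_elim (use c_pos in simp)
    qed
    have "\<forall>\<^sub>F n in sequentially. exp (- (real (K n) * (c / sqrt (real n)))) / (c / sqrt (real n)) < exp (- c * u) / c + 1"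
      by (rule order_tendstoD(2)[OF th(1)]) simp
    then show "\<forall>\<^sub>F n in sequentially. exp (- (real (K n) * (c / sqrt (real n)))) / (c / sqrt (real n)) \<le> exp (- c * u) / c + 1"
      by eventually_elim simp
  qed
  then have lim: "(\<lambda>n. card (bounded_partitions (K n) n) / card (bounded_partitions n n)) \<longlonglongrightarrow> exp (- (1 / c) * exp (- c * u))"
    by simp
  show ?thesis
  proof (rule Lim_transform_eventually[OF lim])
    show "\<forall>\<^sub>F n in sequentially. card (bounded_partitions (K n) n) / card (bounded_partitions n n) =
      card {ps \<in> int_partitions n. largest_part ps \<le> K n} / card (int_partitions n)"
      using eventually_gt_at_top[of 0]
      proof eventually_elim
      case (elim n)
      show ?case
        unfolding int_partitions_le_eq_bounded_partitions[OF elim]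
        unfolding int_partitions_eq_bounded_partitions[OF elim order_refl] ..
    qed
  qed
qed

lemma card_int_partitions_pred_ratio:
  "(\<lambda>n. card (int_partitions (n - 1)) / card (int_partitions n)) \<longlonglongrightarrow> 1"
proof -
  have "(\<lambda>n. card (bounded_partitions n (n - 1)) / card (bounded_partitions n n)) \<longlonglongrightarrow> exp (- 0)"
    by (rule card_bounded_partitions_ratio_tendsto[OF _ log_gf_self_bounded])
       (simp only: of_real_0 log_gf_self_tendsto)
  then have lim: "(\<lambda>n. card (bounded_partitions n (n - 1)) / card (bounded_partitions n n)) \<longlonglongrightarrow> 1"
    by simp
  show ?thesis
  proof (rule Lim_transform_eventually[OF lim])
    show "\<forall>\<^sub>F n in sequentially. card (bounded_partitions n (n - 1)) / card (bounded_partitions n n) =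
      card (int_partitions (n - 1)) / card (int_partitions n)"
      using eventually_gt_at_top[of 1]
      proof eventually_elim
      case (elim n)
      then show ?case
        using int_partitions_eq_bounded_partitions[of "n - 1" n] int_partitions_eq_bounded_partitions[of n n] by simp
    qed
  qed
qed

theorem corollary1:
  fixes c u :: real
  assumes "c = pi / sqrt 6"
  shows "(\<lambda>n. partition_prob n (\<lambda>ps.
            real (largest_part ps) * real (largest_part_mult ps) / sqrt (real n)
              - 1 / (2 * c) * ln (real n) \<le> u))
         \<longlonglongrightarrow> exp (- (1 / c) * exp (- c * u))"
proof -
  have c_pos: "c > 0" using assms by simp
  \<comment> \<open>\<open>E n\<close> is the event of the theorem, \<open>F n\<close> the event that the largest part is at most \<open>K n\<close>, and
    \<open>U n\<close> the event that the largest part is simple. Then \<open>E n \<subseteq> F n\<close>, and \<open>F n - E n\<close> is disjoint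
    from \<open>U n\<close>.\<close>
  define K where "K n = nat \<lfloor>sqrt (real n) * (ln (real n) / (2 * c) + u)\<rfloor>" for n
  define p where "p n = card (int_partitions n)" for n
  define F where "F n = {ps \<in> int_partitions n. largest_part ps \<le> K n}" for n
  define E where "E n = {ps \<in> int_partitions n. real (largest_part ps) * real (largest_part_mult ps) / sqrt (real n)
              - 1 / (2 * c) * ln (real n) \<le> u}" for n
  define U where "U n = {ps \<in> int_partitions n. largest_part_mult ps = 1}" for n
  have fin: "finite (F n)" "finite (E n)" "finite (U n)" for n
    by (simp_all add: F_def E_def U_def finite_int_partitions)
  have F_lim: "(\<lambda>n. card (F n) / p n) \<longlonglongrightarrow> exp (- (1 / c) * exp (- c * u))"
    unfolding F_def p_def K_def by (rule largest_part_limit[OF assms])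
  have "(\<lambda>n. card (F n) / p n - (1 - p (n - 1) / p n)) \<longlonglongrightarrow> exp (- (1 / c) * exp (- c * u)) - (1 - 1)"
    by (intro tendsto_intros F_lim card_int_partitions_pred_ratio[folded p_def])
  then have lower_lim: "(\<lambda>n. card (F n) / p n - (1 - p (n - 1) / p n)) \<longlonglongrightarrow> exp (- (1 / c) * exp (- c * u))"
    by simp
  have "filterlim (\<lambda>n. sqrt (real n) * (ln (real n) / (2 * c) + u)) at_top sequentially"
    using c_pos by real_asymp
  then have y_nonneg: "\<forall>\<^sub>F n in sequentially. sqrt (real n) * (ln (real n) / (2 * c) + u) \<ge> 0"
    by (simp add: filterlim_at_top)
  have E_iff: "ps \<in> E n \<longleftrightarrow> ps \<in> int_partitions n \<and> largest_part ps * largest_part_mult ps \<le> K n"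
    if n: "n > 0" "sqrt (real n) * (ln (real n) / (2 * c) + u) \<ge> 0" for n ps
  proof -
    have "real (largest_part ps) * real (largest_part_mult ps) / sqrt (real n) - 1 / (2 * c) * ln (real n) \<le> u \<longleftrightarrow>
      real (largest_part ps * largest_part_mult ps) \<le> sqrt (real n) * (ln (real n) / (2 * c) + u)"
      using n c_pos by (simp add: field_simps)
    also have "\<dots> \<longleftrightarrow> largest_part ps * largest_part_mult ps \<le> K n"
      using n(2) unfolding K_def by (simp add: le_nat_iff le_floor_iff)
    finally show ?thesis by (simp add: E_def)
  qed
  have bounds: "\<forall>\<^sub>F n in sequentially. card (F n) / p n - (1 - p (n - 1) / p n) \<le> card (E n) / p n \<and> card (E n) / p n \<le> card (F n) / p n"
    using y_nonneg eventually_gt_at_top[of 0]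
  proof eventually_elim
    case (elim n)
    have p_pos: "p n > 0"
      using int_partitions_nonempty[OF elim(2)] finite_int_partitions[of n] by (simp add: p_def card_gt_0_iff)
    have "E n \<subseteq> F n"
    proof
      fix ps assume "ps \<in> E n"
      then have ps: "ps \<in> int_partitions n" "largest_part ps * largest_part_mult ps \<le> K n"
        using elim by (auto simp: E_iff)
      then have "hd ps \<in> set ps" by (simp add: int_partitions_def)
      then have "largest_part_mult ps \<ge> 1"
        using count_list_0_iff[of ps "hd ps"] by (simp add: largest_part_mult_def)
      then have "largest_part ps \<le> largest_part ps * largest_part_mult ps" by simp
      then have "largest_part ps \<le> K n" using ps(2) by (rule order_trans)
      with ps(1) show "ps \<in> F n" by (simp add: F_def)
    qed
    then have upper: "card (E n) \<le> card (F n)" by (intro card_mono fin)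
    have "F n \<subseteq> E n \<union> (int_partitions n - U n)"
      using elim by (auto simp: E_iff F_def U_def)
    then have "card (F n) \<le> card (E n \<union> (int_partitions n - U n))"
      by (intro card_mono finite_UnI fin finite_Diff finite_int_partitions)
    also have "\<dots> \<le> card (E n) + card (int_partitions n - U n)" by (rule card_Un_le)
    also have "card (int_partitions n - U n) = p n - card (U n)"
      unfolding p_def by (intro card_Diff_subset fin) (auto simp: U_def)
    finally have "card (F n) \<le> card (E n) + (p n - card (U n))" .
    moreover have "card (U n) \<le> p n"
      unfolding p_def U_def by (intro card_mono finite_int_partitions) auto
    moreover have "p (n - 1) \<le> card (U n)"
      using card_int_partitions_le_unique_largest[of "n - 1"] elim by (simp add: p_def U_def)
    ultimately have "real (card (F n)) - (real (p n) - real (p (n - 1))) \<le> real (card (E n))" by linarith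
    then have "(real (card (F n)) - (real (p n) - real (p (n - 1)))) / p n \<le> card (E n) / p n"
      by (intro divide_right_mono) auto
    moreover have "(real (card (F n)) - (real (p n) - real (p (n - 1)))) / p n = card (F n) / p n - (1 - p (n - 1) / p n)"
      using p_pos by (simp add: diff_divide_distrib)
    moreover have "card (E n) / p n \<le> card (F n) / p n"
      using upper by (intro divide_right_mono) auto
    ultimately show ?case by simp
  qed
  have E_lim: "(\<lambda>n. card (E n) / p n) \<longlonglongrightarrow> exp (- (1 / c) * exp (- c * u))"
    by (rule tendsto_sandwich[OF _ _ lower_lim F_lim]) (use bounds in \<open>auto elim: eventually_mono\<close>)
  show ?thesis
  proof (rule Lim_transform_eventually[OF E_lim])
    show "\<forall>\<^sub>F n in sequentially. card (E n) / p n = partition_prob n (\<lambda>ps.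
            real (largest_part ps) * real (largest_part_mult ps) / sqrt (real n)
              - 1 / (2 * c) * ln (real n) \<le> u)"
      using eventually_gt_at_top[of 0]
    proof eventually_elim
      case (elim n)
      show ?case
        unfolding partition_prob_def measure_pmf_of_set[OF int_partitions_nonempty[OF elim] finite_int_partitions]
        by (simp add: E_def p_def Int_def)
    qed
  qed
qed

end
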